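(* Let $n\ge 2$, let $\Gamma$ be a discrete cocompact subgroup of $SU(n,1)$ such that $\Gamma\backslash B^n$ is smooth, and let $\gamma_0\in\Gamma$ be a loxodromic element whose eigenvalues are $\tau_1,\dots,\tau_{n-1},\lambda,\lambda^{-1}$ with $|\tau_j|=1$, $\lambda\in\mathbb{R}$, $|\lambda|>1$, with corresponding eigenvectors $v_1,\dots,v_{n-1}$ (positive) and $X,Y$ (null). Let $1\le m\le n-1$ and suppose $v_1,\dots,v_m$ correspond to the eigenvalue $1$. Let $l=(l_1,\dots,l_m)$ be positive integers such that $l_1+\dots+l_m$ is even, let $k\ge 1$ be an integer, let $\Gamma_0=\langle\gamma_0\rangle$, and set $$q_l(z)=\frac{\langle z,v_1\rangle^{l_1}\cdots\langle z,v_m\rangle^{l_m}}{(\langle z,X\rangle\langle z,Y\rangle)^{(n+1)k+\frac{l_1+\dots+l_m}{2}}},\qquad z\in B^n.$$ Then the relative Poincaré series $$\Theta_{\gamma_0,l,k}(z)=\sum_{\gamma\in\Gamma_0\backslash\Gamma}q_l(\gamma z)(\det J(\gamma,z))^{2k}$$ converges absolutely in $B^n$ and uniformly on compact sets, and belongs to $S_{2(n+1)k}(\Gamma)$.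
   Context: $B^n$ is the open unit ball in $\mathbb{C}^n$. On $\mathbb{C}^{n+1}$ use $\langle z,w\rangle=z_1\bar w_1+\dots+z_n\bar w_n-z_{n+1}\bar w_{n+1}$. A nonzero vector $z\in\mathbb{C}^{n+1}$ is negative, null or positive if $\langle z,z\rangle$ is negative, zero or positive, respectively. A point $z\in B^n$ is identified with the vector $(z_1,\dots,z_n,1)^T$ inside $\langle\cdot,\cdot\rangle$. The group $SU(n,1)$ acts on $B^n$ by fractional-linear transformations (apply the matrix to $(z_1,\dots,z_n,1)^T$ and divide by the last coordinate), and $J(\gamma,z)$ is the Jacobi matrix of $\gamma$ at $z$. If the last row of $\gamma\in SU(n,1)$ is $(c_1,\dots,c_n,d)$, then $\det J(\gamma,z)=(c_1z_1+\dots+c_nz_n+d)^{-(n+1)}$. An automorphism of $B^n$ is loxodromic if it has no fixed points in $B^n$ and fixes exactly two points of $\partial B^n$. For a positive integer $j$, $S_{(n+1)j}(\Gamma)$ denotes the space of holomorphic functions $f:B^n\to\mathbb{C}$ with $f(\gamma z)(\det J(\gamma,z))^{j}=f(z)$ for all $\gamma\in\Gamma$, $z\in B^n$ (cusp forms of weight $(n+1)j$). Thus $S_{2(n+1)k}(\Gamma)$ is the case $j=2k$. The sum is over the cosets $\Gamma_0\gamma$; each term depends only on the coset. *)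

theory Defs
  imports "HOL-Analysis.Analysis" "HOL-Algebra.Generated_Groups"
begin

section \<open>The Hermitian form and the group \<open>SU(n,1)\<close>\<close>

text \<open>
  Vectors of \<open>\<complex>\<^sup>n\<^sup>+\<^sup>1\<close> are indexed by \<^typ>\<open>'n option\<close>: the coordinates \<open>1, \<dots>, n\<close> are
  \<open>Some j\<close>, and the last coordinate \<open>n + 1\<close> is \<open>None\<close>.  Here \<open>n\<close> is \<open>CARD('n)\<close>.
\<close>

definition herm :: "complex ^ 'n::finite option \<Rightarrow> complex ^ 'n option \<Rightarrow> complex"
  where "herm z w = (\<Sum>j\<in>UNIV. z $ Some j * cnj (w $ Some j)) - z $ None * cnj (w $ None)"

lemma herm_self_real: "Im (herm z z) = 0"
  by (simp add: herm_def)

definition positive_vec :: "complex ^ 'n::finite option \<Rightarrow> bool"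
  where "positive_vec z \<longleftrightarrow> z \<noteq> 0 \<and> Re (herm z z) > 0"

definition null_vec :: "complex ^ 'n::finite option \<Rightarrow> bool"
  where "null_vec z \<longleftrightarrow> z \<noteq> 0 \<and> herm z z = 0"

definition SU :: "(complex ^ 'n::finite option ^ 'n option) monoid"
  where "SU = \<lparr>carrier = {g. det g = 1 \<and> (\<forall>z w. herm (g *v z) (g *v w) = herm z w)},
                mult = (**), one = mat 1\<rparr>"

lemma group_SU: "group (SU :: (complex ^ 'n::finite option ^ 'n option) monoid)"
proof (rule groupI)
  fix g :: "complex ^ 'n option ^ 'n option"
  assume "g \<in> carrier SU"
  then have d: "det g = 1" and h: "\<And>z w. herm (g *v z) (g *v w) = herm z w"
    by (auto simp: SU_def)
  have "invertible g"
    using d by (simp add: invertible_det_nz)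
  then obtain g' where g': "g ** g' = mat 1" "g' ** g = mat 1"
    unfolding invertible_def by blast
  have "det g' = 1"
    using d g'(1) by (metis det_I det_mul mult_1)
  moreover have "herm (g' *v z) (g' *v w) = herm z w" for z w
    using h[of "g' *v z" "g' *v w"] g'(1)
    by (simp add: matrix_vector_mul_assoc matrix_vector_mul_lid)
  ultimately show "\<exists>y\<in>carrier SU. y \<otimes>\<^bsub>SU\<^esub> g = \<one>\<^bsub>SU\<^esub>"
    using g'(2) by (intro bexI[of _ g']) (auto simp: SU_def)
qed (auto simp: SU_def det_mul matrix_mul_assoc matrix_vector_mul_assoc[symmetric])

section \<open>The action on the unit ball\<close>

definition lift :: "complex ^ 'n::finite \<Rightarrow> complex ^ 'n option"
  where "lift z = (\<chi> i. case i of None \<Rightarrow> 1 | Some j \<Rightarrow> z $ j)"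

definition act :: "complex ^ 'n::finite option ^ 'n option \<Rightarrow> complex ^ 'n \<Rightarrow> complex ^ 'n"
  where "act g z = (\<chi> j. (g *v lift z) $ Some j / (g *v lift z) $ None)"

definition jacobi :: "complex ^ 'n::finite option ^ 'n option \<Rightarrow> complex ^ 'n \<Rightarrow> complex ^ 'n ^ 'n"
  where "jacobi g z = (\<chi> i j. deriv (\<lambda>t. act g (\<chi> k. if k = j then t else z $ k) $ i) (z $ j))"

definition loxodromic :: "complex ^ 'n::finite option ^ 'n option \<Rightarrow> bool"
  where "loxodromic g \<longleftrightarrow>
    (\<forall>z\<in>ball 0 1. act g z \<noteq> z) \<and> card {z \<in> sphere 0 1. act g z = z} = 2"

definition holo_on :: "(complex ^ 'n::finite \<Rightarrow> complex) \<Rightarrow> (complex ^ 'n) set \<Rightarrow> bool"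
    (infix \<open>holo'_on\<close> 50)
  where "f holo_on U \<longleftrightarrow>
    (\<forall>z\<in>U. \<exists>D. (f has_derivative D) (at z) \<and> (\<forall>c v. D (c *s v) = c * D v))"

section \<open>Quotients by \<open>\<Gamma>\<close>\<close>

definition quotient_topology :: "'a topology \<Rightarrow> ('a \<Rightarrow> 'b) \<Rightarrow> 'b topology"
  where "quotient_topology T p =
    topology (\<lambda>U. U \<subseteq> p ` topspace T \<and> openin T {x \<in> topspace T. p x \<in> U})"

lemma openin_quotient_topology:
  "openin (quotient_topology T p) U \<longleftrightarrow>
    U \<subseteq> p ` topspace T \<and> openin T {x \<in> topspace T. p x \<in> U}"
proof -
  have "istopology (\<lambda>U. U \<subseteq> p ` topspace T \<and> openin T {x \<in> topspace T. p x \<in> U})"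
    unfolding istopology_def
  proof (intro conjI allI impI)
    fix S U
    assume S: "S \<subseteq> p ` topspace T \<and> openin T {x \<in> topspace T. p x \<in> S}"
      and U: "U \<subseteq> p ` topspace T \<and> openin T {x \<in> topspace T. p x \<in> U}"
    have "{x \<in> topspace T. p x \<in> S \<inter> U} =
      {x \<in> topspace T. p x \<in> S} \<inter> {x \<in> topspace T. p x \<in> U}"
      by blast
    with S U show "openin T {x \<in> topspace T. p x \<in> S \<inter> U}"
      by auto
    from S show "S \<inter> U \<subseteq> p ` topspace T"
      by blast
  next
    fix K
    assume K: "\<forall>S\<in>K. S \<subseteq> p ` topspace T \<and> openin T {x \<in> topspace T. p x \<in> S}"
    have "{x \<in> topspace T. p x \<in> \<Union>K} = (\<Union>S\<in>K. {x \<in> topspace T. p x \<in> S})"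
      by blast
    with K show "openin T {x \<in> topspace T. p x \<in> \<Union>K}"
      by auto
    from K show "\<Union>K \<subseteq> p ` topspace T"
      by blast
  qed
  then show ?thesis
    unfolding quotient_topology_def by (simp add: topology_inverse')
qed

lemma quotient_map_quotient_topology: "quotient_map T (quotient_topology T p) p"
proof -
  have "topspace (quotient_topology T p) = p ` topspace T"
  proof
    show "topspace (quotient_topology T p) \<subseteq> p ` topspace T"
      by (metis openin_quotient_topology openin_topspace)
    have "{x \<in> topspace T. p x \<in> p ` topspace T} = topspace T"
      by blast
    then show "p ` topspace T \<subseteq> topspace (quotient_topology T p)"
      by (intro openin_subset) (simp add: openin_quotient_topology)
  qed
  then show ?thesis
    by (auto simp: quotient_map_def openin_quotient_topology)
qed

definition cocompact :: "(complex ^ 'n::finite option ^ 'n option) set \<Rightarrow> bool"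
  where "cocompact \<Gamma> \<longleftrightarrow>
    compact_space (quotient_topology (top_of_set (carrier SU)) (\<lambda>g. \<Gamma> #>\<^bsub>SU\<^esub> g))"

definition orbit :: "(complex ^ 'n::finite option ^ 'n option) set \<Rightarrow> complex ^ 'n \<Rightarrow> (complex ^ 'n) set"
  where "orbit \<Gamma> z = (\<lambda>\<gamma>. act \<gamma> z) ` \<Gamma>"

definition ball_quotient :: "(complex ^ 'n::finite option ^ 'n option) set \<Rightarrow> (complex ^ 'n) set topology"
  where "ball_quotient \<Gamma> = quotient_topology (top_of_set (ball 0 1)) (orbit \<Gamma>)"

text \<open>
  \<open>\<Gamma>\<setminus>B\<^sup>n\<close> carries the quotient topology and the sheaf of functions whose pullbacks to
  \<open>B\<^sup>n\<close> are holomorphic.  It is smooth if this ringed space is locally isomorphic to open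
  subsets of \<open>\<complex>\<^sup>n\<close>, that is, if it is a complex manifold (for discrete \<open>\<Gamma>\<close> the quotient is
  automatically Hausdorff and second countable).
\<close>

definition smooth_quotient :: "(complex ^ 'n::finite option ^ 'n option) set \<Rightarrow> bool"
  where "smooth_quotient \<Gamma> \<longleftrightarrow>
    (\<forall>p \<in> topspace (ball_quotient \<Gamma>). \<exists>W (D :: (complex ^ 'n) set) \<psi>.
       openin (ball_quotient \<Gamma>) W \<and> p \<in> W \<and> open D \<and>
       homeomorphic_map (subtopology (ball_quotient \<Gamma>) W) (top_of_set D) \<psi> \<and>
       (\<forall>V h. open V \<and> V \<subseteq> D \<longrightarrow>
          (h holo_on V \<longleftrightarrow>
           (h \<circ> \<psi> \<circ> orbit \<Gamma>) holo_on {z \<in> ball 0 1. orbit \<Gamma> z \<in> W \<and> \<psi> (orbit \<Gamma> z) \<in> V})))"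

section \<open>Cusp forms and relative Poincare series\<close>

text \<open>\<open>cusp_forms \<Gamma> j\<close> is the space of cusp forms of weight \<open>(n + 1) j\<close>.\<close>

definition cusp_forms ::
  "(complex ^ 'n::finite option ^ 'n option) set \<Rightarrow> nat \<Rightarrow> (complex ^ 'n \<Rightarrow> complex) set"
  where "cusp_forms \<Gamma> j = {f. f holo_on ball 0 1 \<and>
    (\<forall>\<gamma>\<in>\<Gamma>. \<forall>z\<in>ball 0 1. f (act \<gamma> z) * det (jacobi \<gamma> z) ^ j = f z)}"

definition q_fun ::
  "(nat \<Rightarrow> complex ^ 'n::finite option) \<Rightarrow> complex ^ 'n option \<Rightarrow> complex ^ 'n option \<Rightarrow>
   nat \<Rightarrow> (nat \<Rightarrow> nat) \<Rightarrow> nat \<Rightarrow> complex ^ 'n \<Rightarrow> complex"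
  where "q_fun v X Y m l k z =
    (\<Prod>i = 1..m. herm (lift z) (v i) ^ l i) /
    (herm (lift z) X * herm (lift z) Y) ^ ((CARD('n) + 1) * k + (\<Sum>i = 1..m. l i) div 2)"

text \<open>
  The cosets \<open>\<Gamma>\<^sub>0\<gamma>\<close> with \<open>\<gamma> \<in> \<Gamma>\<close>, where \<open>\<Gamma>\<^sub>0\<close> is the cyclic group generated by \<open>\<gamma>\<^sub>0\<close>.
\<close>

definition cyclic_cosets ::
  "(complex ^ 'n::finite option ^ 'n option) set \<Rightarrow> complex ^ 'n option ^ 'n option \<Rightarrow>
   (complex ^ 'n option ^ 'n option) set set"
  where "cyclic_cosets \<Gamma> \<gamma>\<^sub>0 = rcosets\<^bsub>SU\<lparr>carrier := \<Gamma>\<rparr>\<^esub> (generate SU {\<gamma>\<^sub>0})"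

text \<open>
  The term of the series at a coset \<open>C\<close> is the common value of \<open>q (\<gamma> z) (det J(\<gamma>, z))\<^sup>2\<^sup>k\<close>
  over all \<open>\<gamma> \<in> C\<close>; it is unspecified if that value depended on the representative.
\<close>

definition poincare_term ::
  "(complex ^ 'n::finite \<Rightarrow> complex) \<Rightarrow> nat \<Rightarrow> (complex ^ 'n option ^ 'n option) set \<Rightarrow>
   complex ^ 'n \<Rightarrow> complex"
  where "poincare_term q k C z =
    the_elem ((\<lambda>\<gamma>. q (act \<gamma> z) * det (jacobi \<gamma> z) ^ (2 * k)) ` C)"

definition Theta ::
  "(complex ^ 'n::finite option ^ 'n option) set \<Rightarrow> complex ^ 'n option ^ 'n option \<Rightarrow>
   (complex ^ 'n \<Rightarrow> complex) \<Rightarrow> nat \<Rightarrow> complex ^ 'n \<Rightarrow> complex"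
  where "Theta \<Gamma> \<gamma>\<^sub>0 q k z = (\<Sum>\<^sub>\<infinity>C\<in>cyclic_cosets \<Gamma> \<gamma>\<^sub>0. poincare_term q k C z)"

end

theory Submission
  imports Defs "HOL-Combinatorics.Permutations" "HOL-Complex_Analysis.Cauchy_Integral_Formula"
begin

text \<open>
  Let \<open>F\<close> be the extension of \<open>q\<^sub>l\<close> to negative vectors, homogeneous of degree \<open>-2(n + 1)k\<close>.
  As \<open>det J(\<gamma>, z)\<close> is the power \<open>-(n + 1)\<close> of the last coordinate of \<open>\<gamma>z\<close>, the term of the series at
  \<open>\<Gamma>\<^sub>0\<gamma>\<close> is \<open>F(\<gamma>z)\<close>, and since \<open>\<gamma>\<^sub>0\<close> scales \<open>X\<close> and \<open>Y\<close> by reciprocal reals and fixes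
  \<open>v\<^sub>1, \<dots>, v\<^sub>m\<close>, \<open>F\<close> is \<open>\<Gamma>\<^sub>0\<close>-invariant.  For \<open>u\<close> negative, \<open>|\<langle>u, v\<^sub>i\<rangle>|\<^sup>2 \<le> C |\<langle>u, X\<rangle>\<langle>u, Y\<rangle>|\<close>, so
  \<open>|F(\<gamma>z)|\<close> is bounded, locally uniformly in \<open>z\<close>, by a constant times
  \<open>|\<langle>\<gamma>e, X\<rangle>\<langle>\<gamma>e, Y\<rangle>|\<close> to the power \<open>-(n + 1)k\<close>, where \<open>e = (0, \<dots>, 0, 1)\<close>.  Choosing \<open>\<gamma>\<close> in its coset such
  that \<open>|\<langle>\<gamma>e, X\<rangle>|\<close> and \<open>|\<langle>\<gamma>e, Y\<rangle>|\<close> are comparable, this product dominates \<open>|\<gamma>e|\<^sup>2\<close>, so convergence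
  follows from that of \<open>\<Sum> |\<gamma>e|\<^sup>-\<^sup>2\<^sup>n\<^sup>-\<^sup>2\<close> over \<open>\<Gamma>\<close>.  For this the crude count \<open>O(\<rho>\<^sup>2\<^sup>n\<^sup>+\<^sup>1)\<close> of the
  \<open>\<gamma> \<in> \<Gamma>\<close> with \<open>|\<gamma>e| \<le> \<rho>\<close> suffices, which a pigeonhole argument gives for every discrete \<open>\<Gamma>\<close>.
\<close>

section \<open>The Hermitian form\<close>

text \<open>The Euclidean norm of the first \<open>n\<close> coordinates. The form is its square
  minus the squared modulus of the last coordinate, so all estimates below reduce to Cauchy-Schwarz
  in these coordinates.\<close>

definition spatial_norm :: "complex ^ 'n::finite option \<Rightarrow> real"
  where "spatial_norm z = L2_set (\<lambda>j. norm (z $ Some j)) UNIV"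

lemma herm_add_left: "herm (z + z') w = herm z w + herm z' w"
  by (simp add: herm_def algebra_simps sum.distrib)

lemma herm_scale_left: "herm (c *s z) w = c * herm z w"
  by (simp add: herm_def algebra_simps sum_distrib_left)

lemma herm_add_right: "herm z (w + w') = herm z w + herm z w'"
  by (simp add: herm_def algebra_simps sum.distrib)

lemma herm_scale_right: "herm z (c *s w) = cnj c * herm z w"
  by (simp add: herm_def algebra_simps sum_distrib_left)

lemma herm_diff_left: "herm (z - z') w = herm z w - herm z' w"
  by (simp add: herm_def algebra_simps sum_subtractf)

lemma herm_diff_right: "herm z (w - w') = herm z w - herm z w'"
  by (simp add: herm_def algebra_simps sum_subtractf)

lemmas herm_sesquilinear = herm_add_left herm_add_right herm_diff_left herm_diff_right
  herm_scale_left herm_scale_right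

lemma herm_commute: "herm w z = cnj (herm z w)"
  by (simp add: herm_def mult.commute)

lemma herm_axis_None: "herm z (axis None 1) = - z $ None"
  by (simp add: herm_def axis_def)

lemma spatial_norm_nonneg [simp]: "0 \<le> spatial_norm z"
  by (simp add: spatial_norm_def)

lemma spatial_norm_sq: "(spatial_norm z)\<^sup>2 = (\<Sum>j\<in>UNIV. (norm (z $ Some j))\<^sup>2)"
  by (simp add: spatial_norm_def L2_set_def sum_nonneg)

lemma herm_self: "herm z z = of_real ((spatial_norm z)\<^sup>2 - (norm (z $ None))\<^sup>2)"
  by (simp add: herm_def spatial_norm_sq complex_norm_square[symmetric] flip: of_real_power)

lemma spatial_CS:
  "norm (\<Sum>j\<in>UNIV. z $ Some j * cnj (w $ Some j)) \<le> spatial_norm z * spatial_norm w"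
proof -
  have "norm (\<Sum>j\<in>UNIV. z $ Some j * cnj (w $ Some j))
      \<le> (\<Sum>j\<in>UNIV. \<bar>norm (z $ Some j)\<bar> * \<bar>norm (w $ Some j)\<bar>)"
    by (rule order_trans[OF norm_sum]) (simp add: norm_mult)
  also have "\<dots> \<le> spatial_norm z * spatial_norm w"
    unfolding spatial_norm_def by (rule L2_set_mult_ineq)
  finally show ?thesis .
qed

lemma norm_herm_le:
  "norm (herm z w) \<le> spatial_norm z * spatial_norm w + norm (z $ None) * norm (w $ None)"
  unfolding herm_def
  using norm_triangle_ineq4[of "\<Sum>j\<in>UNIV. z $ Some j * cnj (w $ Some j)" "z $ None * cnj (w $ None)"]
    spatial_CS[of z w] by (simp add: norm_mult)

lemma norm_herm_ge:
  "norm (herm z w) \<ge> norm (z $ None) * norm (w $ None) - spatial_norm z * spatial_norm w"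
  unfolding herm_def
  using norm_triangle_ineq3[of "\<Sum>j\<in>UNIV. z $ Some j * cnj (w $ Some j)" "z $ None * cnj (w $ None)"]
    spatial_CS[of z w] by (simp add: norm_mult)

lemma spatial_norm_component: "norm (z $ Some j) \<le> spatial_norm z"
  unfolding spatial_norm_def by (rule member_le_L2_set) auto

lemma spatial_norm_triangle: "spatial_norm (z + w) \<le> spatial_norm z + spatial_norm w"
proof -
  have "spatial_norm (z + w) \<le> L2_set (\<lambda>j. norm (z $ Some j) + norm (w $ Some j)) UNIV"
    unfolding spatial_norm_def by (rule L2_set_mono) (auto intro: norm_triangle_ineq)
  also have "\<dots> \<le> spatial_norm z + spatial_norm w"
    unfolding spatial_norm_def by (rule L2_set_triangle_ineq)
  finally show ?thesis .
qed

lemma spatial_norm_minus: "spatial_norm (z - w) = spatial_norm (w - z)"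
  by (simp add: spatial_norm_def norm_minus_commute)

lemma vec_option_eqI:
  assumes "z $ None = w $ None" "\<And>j. z $ Some j = w $ Some j"
  shows "z = w"
  unfolding vec_eq_iff using assms by (metis option.exhaust)

lemma spatial_norm_eq_0: "spatial_norm z = 0 \<longleftrightarrow> (\<forall>j. z $ Some j = 0)"
  by (simp add: spatial_norm_def L2_set_eq_0_iff)

lemma null_vec_spatial: "null_vec N \<Longrightarrow> spatial_norm N = norm (N $ None)"
  unfolding null_vec_def herm_self
  by (metis diff_eq_diff_eq diff_self norm_ge_zero of_real_eq_0_iff power2_eq_iff_nonneg
      spatial_norm_nonneg)

lemma null_vec_None: "null_vec N \<Longrightarrow> N $ None \<noteq> 0"
proof
  assume N: "null_vec N" "N $ None = 0"
  then have "spatial_norm N = 0"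
    using null_vec_spatial by force
  with N have "N = 0"
    unfolding spatial_norm_eq_0 by (intro vec_option_eqI) auto
  with N show False
    by (simp add: null_vec_def)
qed

section \<open>Vectors orthogonal to null vectors\<close>

text \<open>Orthogonality forces the last term of \<open>herm r X\<close> to balance the spatial
  sum. Since the spatial norm of \<open>X\<close> equals the modulus of its last coordinate,
  Cauchy-Schwarz leaves no room for \<open>r\<close> to be negative.\<close>

lemma orth_null_nonneg:
  assumes X: "null_vec X" and r: "herm r X = 0"
  shows "0 \<le> Re (herm r r)"
proof -
  have "norm (r $ None) * norm (X $ None) \<le> spatial_norm r * norm (X $ None)"
    using norm_herm_ge[of r X] null_vec_spatial[OF X] r by simp
  then have "norm (r $ None) \<le> spatial_norm r"
    using null_vec_None[OF X] by simp
  then have "(norm (r $ None))\<^sup>2 \<le> (spatial_norm r)\<^sup>2"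
    by (intro power_mono) auto
  then show ?thesis
    by (simp add: herm_self)
qed

text \<open>The combination of \<open>X\<close> and \<open>Y\<close> with last coordinate zero is
  isotropic, and the form is positive definite on vectors with last coordinate zero, so this
  combination vanishes.\<close>

lemma herm_null_eq_0_imp_parallel:
  assumes X: "null_vec X" and Y: "null_vec Y" and 0: "herm X Y = 0"
  shows "Y $ None *s X = X $ None *s Y"
proof -
  define Z where "Z = Y $ None *s X - X $ None *s Y"
  have "herm Y X = 0"
    using 0 herm_commute[of Y X] by simp
  then have "herm Z Z = 0"
    using X Y 0 by (simp add: Z_def herm_sesquilinear null_vec_def)
  moreover have "Z $ None = 0"
    by (simp add: Z_def)
  ultimately have "spatial_norm Z = 0"
    by (simp add: herm_self flip: of_real_power)
  with \<open>Z $ None = 0\<close> have "Z = 0"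
    unfolding spatial_norm_eq_0 by (intro vec_option_eqI) auto
  then show ?thesis
    by (simp add: Z_def)
qed

text \<open>The form is positive semidefinite on the orthogonal complement of \<open>X\<close>, so
  the usual discriminant argument applies. It is degenerate there, as \<open>X\<close> lies in its
  own complement, which is why \<open>q = 0\<close> is a separate case.\<close>

lemma orth_null_CS:
  assumes X: "null_vec X" and r: "herm r X = 0" and v: "herm v X = 0"
  shows "(norm (herm r v))\<^sup>2 \<le> Re (herm r r) * Re (herm v v)"
proof -
  define c where "c = herm r v"
  define p q where "p = Re (herm r r)" and "q = Re (herm v v)"
  have vr: "herm v r = cnj c"
    using herm_commute[of v r] by (simp add: c_def)
  have rr: "herm r r = of_real p" "herm v v = of_real q"
    by (simp_all add: p_def q_def herm_self)
  have q0: "0 \<le> q"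
    unfolding q_def by (rule orth_null_nonneg[OF X v])
  \<comment> \<open>The multiple of \<open>v\<close> is taken along \<open>c = herm r v\<close>, so
    that both cross terms are real and a real parameter \<open>t\<close> suffices.\<close>
  have key: "0 \<le> p - 2 * t * (norm c)\<^sup>2 + t\<^sup>2 * (norm c)\<^sup>2 * q" for t :: real
  proof -
    define s where "s = r - (of_real t * c) *s v"
    have "herm s X = 0"
      using r v by (simp add: s_def herm_sesquilinear)
    then have "0 \<le> Re (herm s s)"
      by (rule orth_null_nonneg[OF X])
    also have "herm s s = of_real p - 2 * of_real t * (c * cnj c)
        + (of_real t)\<^sup>2 * (c * cnj c) * of_real q"
      unfolding s_def herm_sesquilinear vr rr c_def[symmetric]
      by (simp add: algebra_simps power2_eq_square)
    also have "\<dots> = of_real (p - 2 * t * (norm c)\<^sup>2 + t\<^sup>2 * (norm c)\<^sup>2 * q)"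
      by (simp flip: complex_norm_square)
    finally show ?thesis
      by simp
  qed
  show ?thesis
  proof (cases "q = 0")
    case True
    have "norm c = 0"
    proof (rule ccontr)
      assume "norm c \<noteq> 0"
      then show False
        \<comment> \<open>With \<open>q = 0\<close> this value of \<open>t\<close> makes the
          right-hand side equal to -1.\<close>
        using key[of "(p + 1) / (2 * (norm c)\<^sup>2)"] True by (simp add: field_simps)
    qed
    then show ?thesis
      using True by (simp add: c_def[symmetric] q_def[symmetric])
  next
    case False
    with q0 have "q > 0" by simp
    have "0 \<le> p - (norm c)\<^sup>2 / q"
      using key[of "1 / q"] \<open>q > 0\<close> by (simp add: field_simps power2_eq_square)
    then show ?thesis
      using \<open>q > 0\<close> by (simp add: c_def[symmetric] q_def[symmetric] p_def[symmetric] field_simps)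
  qed
qed

text \<open>Split off the components of \<open>u\<close> along \<open>X\<close> and \<open>Y\<close>: on the remainder the form is
  positive semidefinite, and its square is at most the negative part contributed by \<open>X\<close>
  and \<open>Y\<close>.\<close>

lemma herm_axis_bound:
  assumes X: "null_vec X" and Y: "null_vec Y" and XY: "herm X Y \<noteq> 0"
    and v: "herm v X = 0" "herm v Y = 0" and u: "Re (herm u u) \<le> 0"
  shows "(norm (herm u v))\<^sup>2
    \<le> 2 * Re (herm v v) / norm (herm X Y) * (norm (herm u X) * norm (herm u Y))"
proof -
  \<comment> \<open>The coefficients are forced by requiring the remainder \<open>r\<close> to be
    orthogonal to both \<open>X\<close> and \<open>Y\<close>.\<close>
  define a where "a = herm u Y / herm X Y"
  define b where "b = herm u X / herm Y X"
  define r where "r = u - a *s X - b *s Y"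
  have YX: "herm Y X = cnj (herm X Y)"
    by (rule herm_commute)
  with XY have YX0: "herm Y X \<noteq> 0" by simp
  have XX: "herm X X = 0" "herm Y Y = 0"
    using X Y by (auto simp: null_vec_def)
  have rX: "herm r X = 0" and rY: "herm r Y = 0"
    using XX XY YX0 by (simp_all add: r_def herm_sesquilinear a_def b_def)
  have Xr: "herm X r = 0" and Yr: "herm Y r = 0"
    using rX rY herm_commute[of X r] herm_commute[of Y r] by simp_all
  have u_eq: "u = a *s X + b *s Y + r"
    by (simp add: r_def)
  have "herm u u = a * cnj b * herm X Y + cnj (a * cnj b * herm X Y) + herm r r"
    unfolding u_eq
    by (simp add: herm_sesquilinear XX rX rY Xr Yr YX algebra_simps)
  then have "Re (herm u u) = 2 * Re (a * cnj b * herm X Y) + Re (herm r r)"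
    by (simp add: algebra_simps)
  with u have "Re (herm r r) \<le> 2 * norm (a * cnj b * herm X Y)"
    using abs_Re_le_cmod[of "a * cnj b * herm X Y"] by linarith
  also have "norm (a * cnj b * herm X Y) = norm (herm u X) * norm (herm u Y) / norm (herm X Y)"
    using XY by (simp add: norm_mult norm_divide a_def b_def YX)
  finally have rr: "Re (herm r r) \<le> 2 * (norm (herm u X) * norm (herm u Y) / norm (herm X Y))" .
  have "herm X v = 0" "herm Y v = 0"
    using v herm_commute[of X v] herm_commute[of Y v] by simp_all
  then have "herm u v = herm r v"
    unfolding u_eq by (simp add: herm_sesquilinear)
  then have "(norm (herm u v))\<^sup>2 \<le> Re (herm r r) * Re (herm v v)"
    using orth_null_CS[OF X rX v(1)] by simp
  also have "\<dots> \<le> 2 * (norm (herm u X) * norm (herm u Y) / norm (herm X Y)) * Re (herm v v)"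
    by (intro mult_right_mono rr orth_null_nonneg[OF X v(1)])
  finally show ?thesis
    by (simp add: mult_ac)
qed

text \<open>The last coordinate is minus the pairing with \<open>e = axis None 1\<close>. Splitting
  \<open>e\<close> along \<open>X\<close>, \<open>Y\<close> and a remainder orthogonal to both, the
  remainder is handled by \<open>herm_axis_bound\<close>, and the resulting geometric mean of the
  two pairings is at most their sum.\<close>

lemma last_coordinate_bound:
  assumes X: "null_vec X" and Y: "null_vec Y" and XY: "herm X Y \<noteq> 0"
  obtains C where "C > 0"
    "\<And>u. Re (herm u u) \<le> 0 \<Longrightarrow> norm (u $ None) \<le> C * (norm (herm u X) + norm (herm u Y))"
proof -
  define e where "e = (axis None 1 :: complex ^ 'a option)"
  define a where "a = herm e Y / herm X Y"
  define b where "b = herm e X / herm Y X"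
  define r where "r = e - a *s X - b *s Y"
  have "herm Y X \<noteq> 0"
    using XY herm_commute[of Y X] by simp
  then have rX: "herm r X = 0" and rY: "herm r Y = 0"
    using XY X Y by (simp_all add: r_def herm_sesquilinear a_def b_def null_vec_def)
  define D where "D = 2 * Re (herm r r) / norm (herm X Y)"
  have D: "D \<ge> 0"
    using orth_null_nonneg[OF X rX] by (simp add: D_def)
  \<comment> \<open>The summand 1 makes the constant strictly positive.\<close>
  have "norm (u $ None) \<le> (norm a + norm b + sqrt D + 1) * (norm (herm u X) + norm (herm u Y))"
    if u: "Re (herm u u) \<le> 0" for u
  proof -
    define x y where "x = norm (herm u X)" and "y = norm (herm u Y)"
    have xy: "x \<ge> 0" "y \<ge> 0" by (simp_all add: x_def y_def)
    have "(norm (herm u r))\<^sup>2 \<le> D * (x * y)"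
      unfolding D_def x_def y_def by (rule herm_axis_bound[OF X Y XY rX rY u])
    also have "\<dots> \<le> D * (x + y)\<^sup>2"
      using D xy by (intro mult_left_mono) (auto simp: power2_eq_square algebra_simps)
    finally have "norm (herm u r) \<le> sqrt (D * (x + y)\<^sup>2)"
      by (rule real_le_rsqrt)
    also have "\<dots> = sqrt D * (x + y)"
      using xy by (simp add: real_sqrt_mult)
    finally have ur: "norm (herm u r) \<le> sqrt D * (x + y)" .
    have "u $ None = - herm u e"
      by (simp add: e_def herm_axis_None)
    also have "e = a *s X + b *s Y + r"
      by (simp add: r_def)
    finally have "norm (u $ None) = norm (cnj a * herm u X + cnj b * herm u Y + herm u r)"
      by (simp only: herm_sesquilinear norm_minus_cancel)
    also have "\<dots> \<le> norm a * x + norm b * y + norm (herm u r)"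
      using norm_triangle_ineq[of "cnj a * herm u X + cnj b * herm u Y" "herm u r"]
        norm_triangle_ineq[of "cnj a * herm u X" "cnj b * herm u Y"]
      by (simp add: norm_mult x_def y_def)
    also have "\<dots> \<le> norm a * (x + y) + norm b * (x + y) + sqrt D * (x + y)"
      using xy ur by (intro add_mono mult_left_mono) auto
    also have "\<dots> \<le> (norm a + norm b + sqrt D + 1) * (x + y)"
      using xy by (simp add: algebra_simps)
    finally show ?thesis
      by (simp add: x_def y_def)
  qed
  moreover have "norm a + norm b + sqrt D + 1 > 0"
    using D by (simp add: add_nonneg_pos)
  ultimately show ?thesis
    using that by blast
qed

section \<open>Discrete subgroups of \<open>SU(n,1)\<close>\<close>

lemma SU_det: "g \<in> carrier SU \<Longrightarrow> det g = 1"
  by (simp add: SU_def)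

lemma SU_herm: "g \<in> carrier SU \<Longrightarrow> herm (g *v z) (g *v w) = herm z w"
  by (simp add: SU_def)

lemma SU_mult [simp]: "g \<otimes>\<^bsub>SU\<^esub> h = g ** h"
  by (simp add: SU_def)

lemma SU_one: "\<one>\<^bsub>SU\<^esub> = mat 1"
  by (simp add: SU_def)

lemma SU_inv_closed: "g \<in> carrier SU \<Longrightarrow> inv\<^bsub>SU\<^esub> g \<in> carrier SU"
  by (rule group.inv_closed[OF group_SU])

lemma SU_inv_mult: "g \<in> carrier SU \<Longrightarrow> inv\<^bsub>SU\<^esub> g ** g = mat 1"
  using group.l_inv[OF group_SU, of g] by (simp add: SU_one)

lemma SU_mult_inv: "g \<in> carrier SU \<Longrightarrow> g ** inv\<^bsub>SU\<^esub> g = mat 1"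
  using group.r_inv[OF group_SU, of g] by (simp add: SU_one)

text \<open>The adjoint for the form is the inverse. This moves the group element to the fixed
  vector, so that pairings become explicit functions of the point.\<close>

lemma SU_herm_adjoint:
  assumes "g \<in> carrier SU"
  shows "herm (g *v u) w = herm u (inv\<^bsub>SU\<^esub> g *v w)"
  using SU_herm[OF assms, of u "inv\<^bsub>SU\<^esub> g *v w"]
  by (simp add: matrix_vector_mul_assoc SU_mult_inv[OF assms])

lemma matrix_vector_mult_axis: "(A *v axis j 1) $ i = (A $ i $ j :: 'a::comm_semiring_1)"
  by (simp add: matrix_vector_mult_def axis_def if_distrib[of "\<lambda>x. _ * x"] cong: if_cong)

lemma herm_axis_self: "herm (axis None 1) (axis None 1) = -1"
  by (simp add: herm_axis_None)

lemma herm_axis_Some: "herm (axis (Some j) 1) w = cnj (w $ Some j)"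
proof -
  have "(\<Sum>i\<in>UNIV. axis (Some j) 1 $ Some i * cnj (w $ Some i))
      = (\<Sum>i\<in>UNIV. if i = j then cnj (w $ Some i) else 0)"
    by (intro sum.cong) (auto simp: axis_def)
  then show ?thesis
    by (simp add: herm_def) (simp add: axis_def)
qed

lemma herm_negative_spatial:
  assumes "herm u u = -1"
  shows "(norm (u $ None))\<^sup>2 = (spatial_norm u)\<^sup>2 + 1"
proof -
  have "Re (herm u u) = -1"
    using assms by simp
  then show ?thesis
    by (simp add: herm_self)
qed

lemma hyperboloid_bounds:
  assumes "herm u u = -1"
  shows "spatial_norm u \<le> norm (u $ None)" "1 \<le> norm (u $ None)"
proof -
  note * = herm_negative_spatial[OF assms]
  then show "spatial_norm u \<le> norm (u $ None)"
    by (intro power2_le_imp_le[of "spatial_norm u"]) auto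
  have "1\<^sup>2 \<le> (norm (u $ None))\<^sup>2"
    using * by simp
  then show "1 \<le> norm (u $ None)"
    by (rule power2_le_imp_le) auto
qed

lemma SU_last_column:
  assumes "g \<in> carrier SU"
  shows "herm (g *v axis None 1) (g *v axis None 1) = -1"
  by (simp add: SU_herm[OF assms] herm_axis_self)

lemma SU_corner_ge_1:
  assumes "g \<in> carrier SU"
  shows "1 \<le> norm (g $ None $ None)"
  using hyperboloid_bounds(2)[OF SU_last_column[OF assms]] by (simp add: matrix_vector_mult_axis)

lemma herm_columns:
  assumes "g \<in> carrier SU"
  shows "herm (g *v axis None 1) (h *v axis None 1) = - cnj ((inv\<^bsub>SU\<^esub> g ** h) $ None $ None)"
  by (simp add: SU_herm_adjoint[OF assms] matrix_vector_mul_assoc herm_commute[of "axis None 1"]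
      herm_axis_None matrix_vector_mult_axis)

text \<open>Up to sign and conjugation the last row of \<open>g\<close> is the last column of its
  inverse, which lies on the hyperboloid and is thus bounded by the corner. Invariance of the form
  then bounds the rest of each column by its last entry.\<close>

lemma SU_entries_le:
  assumes g: "g \<in> carrier SU"
  shows "norm (g $ i $ j) \<le> norm (g $ None $ None) + 1"
proof -
  define R where "R = norm (g $ None $ None)"
  define h where "h = inv\<^bsub>SU\<^esub> g"
  have h: "h \<in> carrier SU"
    unfolding h_def by (rule SU_inv_closed[OF g])
  have R1: "1 \<le> R"
    unfolding R_def by (rule SU_corner_ge_1[OF g])
  have adj: "herm (axis j 1) (h *v axis None 1) = - g $ None $ j" for j
    unfolding h_def SU_herm_adjoint[OF g, symmetric]
    by (simp add: herm_axis_None matrix_vector_mult_axis)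
  have hR: "norm (h $ None $ None) = R"
    using adj[of None]
    by (simp add: R_def herm_commute[of "axis None 1"] herm_axis_None matrix_vector_mult_axis)
       (metis complex_mod_cnj)
  have row: "norm (g $ None $ Some j) \<le> R" for j
  proof -
    have "herm (axis (Some j) 1) (h *v axis None 1) = cnj (h $ Some j $ None)"
      by (simp add: herm_axis_Some matrix_vector_mult_axis)
    then have "norm (g $ None $ Some j) = norm (h $ Some j $ None)"
      using adj[of "Some j"] by (metis complex_mod_cnj norm_minus_cancel)
    also have "\<dots> \<le> spatial_norm (h *v axis None 1)"
      using spatial_norm_component[of "h *v axis None 1" j] by (simp add: matrix_vector_mult_axis)
    also have "\<dots> \<le> R"
      using hyperboloid_bounds(1)[OF SU_last_column[OF h]] hR by (simp add: matrix_vector_mult_axis)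
    finally show ?thesis .
  qed
  have row': "norm (g $ None $ j) \<le> R" for j
    using row by (cases j) (auto simp: R_def)
  have "norm (g $ Some i $ j) \<le> R + 1" for i j
  proof -
    \<comment> \<open>A column of \<open>g\<close> has the same form value as the unit vector it
      comes from, which is 1 or -1.\<close>
    have "Re (herm (g *v axis j 1) (g *v axis j 1)) = Re (herm (axis j 1) (axis j 1))"
      by (simp add: SU_herm[OF g])
    also have "\<dots> \<le> 1"
    proof (cases j)
      case (Some i)
      show ?thesis
        unfolding Some by (simp only: herm_axis_Some) (simp add: axis_def)
    qed (simp add: herm_axis_self)
    finally have "(spatial_norm (g *v axis j 1))\<^sup>2 \<le> 1 + (norm (g $ None $ j))\<^sup>2"
      by (simp add: herm_self matrix_vector_mult_axis)
    also have "\<dots> \<le> 1 + R\<^sup>2"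
      using row'[of j] by (intro add_left_mono power_mono) auto
    also have "\<dots> \<le> (R + 1)\<^sup>2"
      using R1 by (simp add: power2_eq_square algebra_simps)
    finally have "spatial_norm (g *v axis j 1) \<le> R + 1"
      by (rule power2_le_imp_le) (use R1 in simp)
    then show ?thesis
      using spatial_norm_component[of "g *v axis j 1" i] by (simp add: matrix_vector_mult_axis)
  qed
  moreover have "norm (g $ None $ j) \<le> R + 1" for j
    using row'[of j] by simp
  ultimately show ?thesis
    by (cases i) (auto simp: R_def)
qed

lemma SU_inv_corner:
  assumes g: "g \<in> carrier SU"
  shows "norm ((inv\<^bsub>SU\<^esub> g) $ None $ None) = norm (g $ None $ None)"
proof -
  have "herm (g *v axis None 1) (axis None 1) = herm (axis None 1) (inv\<^bsub>SU\<^esub> g *v axis None 1)"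
    by (rule SU_herm_adjoint[OF g])
  then show ?thesis
    by (simp add: herm_commute[of "axis None 1"] herm_axis_None matrix_vector_mult_axis)
qed

lemma norm_matrix_le:
  fixes A :: "complex ^ 'm::finite ^ 'k::finite" and B :: real
  assumes "\<And>i j. norm (A $ i $ j) \<le> B"
  shows "norm A \<le> real CARD('k) * real CARD('m) * B"
proof -
  have "norm A \<le> (\<Sum>i\<in>UNIV. norm (A $ i))"
    by (simp add: norm_vec_def L2_set_le_sum)
  also have "\<dots> \<le> (\<Sum>i\<in>UNIV. \<Sum>j\<in>UNIV. norm (A $ i $ j))"
    by (intro sum_mono) (simp add: norm_vec_def L2_set_le_sum)
  also have "\<dots> \<le> (\<Sum>i\<in>(UNIV::'k set). \<Sum>j\<in>(UNIV::'m set). B)"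
    by (rule sum_mono, rule sum_mono, rule assms)
  finally show ?thesis
    by simp
qed

lemma norm_matrix_component: "norm ((A :: complex ^ 'm::finite ^ 'k::finite) $ i $ j) \<le> norm A"
  by (meson Finite_Cartesian_Product.norm_nth_le order_trans)

lemma discrete_subgroup_finite:
  fixes \<Gamma> :: "(complex ^ 'n::finite option ^ 'n option) set"
  assumes sub: "subgroup \<Gamma> SU" and disc: "discrete \<Gamma>"
  shows "finite {g \<in> \<Gamma>. norm (g $ None $ None) \<le> R}"
proof (rule ccontr)
  define S where "S = {g \<in> \<Gamma>. norm (g $ None $ None) \<le> R}"
  assume "infinite {g \<in> \<Gamma>. norm (g $ None $ None) \<le> R}"
  then have inf: "infinite S"
    by (simp add: S_def)
  let ?N = "real CARD('n option)"
  have SU: "g \<in> carrier SU" if "g \<in> \<Gamma>" for g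
    using subgroup.mem_carrier[OF sub that] .
  have "bounded S"
    unfolding bounded_iff
  proof (intro exI ballI)
    fix g assume "g \<in> S"
    then have "norm (g $ i $ j) \<le> R + 1" for i j
      using SU_entries_le[OF SU, of g i j] by (simp add: S_def)
    then show "norm g \<le> ?N * ?N * (R + 1)"
      by (rule norm_matrix_le)
  qed
  then obtain x where x: "x islimpt S"
    using bounded_infinite_imp_islimpt[OF subset_refl _ inf] by blast
  have "mat 1 \<in> \<Gamma>"
    using subgroup.one_closed[OF sub] by (simp add: SU_one)
  then obtain d where d: "d > 0" "\<And>h. h \<in> \<Gamma> \<Longrightarrow> dist (mat 1) h < d \<Longrightarrow> h = mat 1"
    using disc unfolding discrete_def isolated_in_dist_Ex_iff by metis
  obtain g0 where "g0 \<in> S"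
    using inf by (metis finite.emptyI ex_in_conv)
  then have R0: "R \<ge> 1"
    using SU_corner_ge_1[OF SU, of g0] by (auto simp: S_def)
  \<comment> \<open>Left multiplication by the inverse of an element of \<open>S\<close> expands
    norms by at most \<open>K\<close>: each of the \<open>?N * ?N\<close> entries of the product is
    a sum of \<open>?N\<close> terms, with a factor at most \<open>R + 1\<close>.\<close>
  define K where "K = ?N * ?N * (?N * (R + 1))"
  have K: "K > 0"
    using R0 by (simp add: K_def)
  define \<epsilon> where "\<epsilon> = d / (2 * (K + 1))"
  have \<epsilon>: "\<epsilon> > 0"
    using d K by (simp add: \<epsilon>_def)
  have "infinite (S \<inter> ball x (\<epsilon> / 2))"
    using x \<epsilon> unfolding islimpt_eq_infinite_ball by (meson half_gt_zero)
  then obtain g where g: "g \<in> S" "dist x g < \<epsilon> / 2"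
    by (metis Int_iff ex_in_conv finite.emptyI mem_ball)
  from \<open>infinite (S \<inter> ball x (\<epsilon> / 2))\<close> have "infinite ((S \<inter> ball x (\<epsilon> / 2)) - {g})"
    by simp
  from infinite_imp_nonempty[OF this] obtain h where "h \<in> S \<inter> ball x (\<epsilon> / 2) - {g}"
    by blast
  then have h: "h \<in> S" "dist x h < \<epsilon> / 2" "h \<noteq> g"
    by auto
  have gh: "norm (h - g) \<le> \<epsilon>"
    using dist_triangle2[of g h x] g h by (simp add: dist_norm dist_commute norm_minus_commute)
  define g' where "g' = inv\<^bsub>SU\<^esub> g"
  have gS: "g \<in> carrier SU" "g \<in> \<Gamma>" "h \<in> \<Gamma>"
    using g h SU by (auto simp: S_def)
  have g': "g' \<in> \<Gamma>"
    unfolding g'_def using subgroup.m_inv_closed[OF sub gS(2)] .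
  have "norm (g' $ i $ j) \<le> R + 1" for i j
    using SU_entries_le[OF SU[OF g'], of i j] SU_inv_corner[OF gS(1)] g
    by (simp add: g'_def S_def)
  then have "norm ((g' ** (h - g)) $ i $ j) \<le> ?N * ((R + 1) * \<epsilon>)" for i j
  proof -
    have "norm ((g' ** (h - g)) $ i $ j)
        \<le> (\<Sum>k\<in>(UNIV :: 'n option set). norm (g' $ i $ k * (h - g) $ k $ j))"
      unfolding matrix_matrix_mult_def by (simp only: vec_lambda_beta) (rule norm_sum)
    also have "\<dots> \<le> (\<Sum>k\<in>(UNIV :: 'n option set). (R + 1) * \<epsilon>)"
      unfolding norm_mult
      using \<open>\<And>i j. norm (g' $ i $ j) \<le> R + 1\<close> R0 gh
      by (intro sum_mono mult_mono order_trans[OF norm_matrix_component gh]) auto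
    finally show ?thesis
      by simp
  qed
  then have "norm (g' ** (h - g)) \<le> ?N * ?N * (?N * ((R + 1) * \<epsilon>))"
    by (rule norm_matrix_le)
  also have "\<dots> = K * \<epsilon>"
    by (simp add: K_def)
  also have "\<dots> < d"
    using d(1) K by (simp add: \<epsilon>_def field_simps) (simp add: add_pos_pos)
  finally have "norm (g' ** (h - g)) < d" .
  moreover have "g' ** (h - g) = g' ** h - mat 1"
    using SU_inv_mult[OF gS(1)] by (simp add: g'_def vec_eq_iff matrix_matrix_mult_def algebra_simps sum_subtractf)
  ultimately have "dist (mat 1) (g' ** h) < d"
    by (simp add: dist_norm norm_minus_commute)
  moreover have "g' ** h \<in> \<Gamma>"
    using subgroup.m_closed[OF sub g' gS(3)] by simp
  ultimately have "g' ** h = mat 1"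
    using d by blast
  then have "g ** (g' ** h) = g"
    by simp
  then have "h = g"
    by (simp add: g'_def matrix_mul_assoc SU_mult_inv[OF gS(1)])
  with h show False
    by simp
qed

section \<open>Counting elements of a discrete subgroup\<close>

text \<open>The last column rotated by a unit scalar so that its last coordinate becomes positive.
  The rotation keeps the moduli of pairings, and it makes last coordinates of different columns
  comparable.\<close>

definition phase_column :: "complex ^ 'n::finite option ^ 'n option \<Rightarrow> complex ^ 'n option"
  where "phase_column g =
    (cnj (g $ None $ None) / of_real (norm (g $ None $ None))) *s (g *v axis None 1)"

lemma norm_herm_phase_column:
  assumes g: "g \<in> carrier SU" and h: "h \<in> carrier SU"
  shows "norm (herm (phase_column g) (phase_column h)) = norm ((inv\<^bsub>SU\<^esub> g ** h) $ None $ None)"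
proof -
  have "norm (g $ None $ None) \<noteq> 0" "norm (h $ None $ None) \<noteq> 0"
    using SU_corner_ge_1[OF g] SU_corner_ge_1[OF h] by linarith+
  then show ?thesis
    by (simp add: phase_column_def herm_sesquilinear norm_mult norm_divide herm_columns[OF g])
qed

lemma phase_column_None:
  assumes g: "g \<in> carrier SU"
  shows "phase_column g $ None = of_real (norm (g $ None $ None))"
proof -
  define t where "t = g $ None $ None"
  have "norm t \<noteq> 0"
    using SU_corner_ge_1[OF g] unfolding t_def by linarith
  moreover have "cnj t * t = (of_real (norm t))\<^sup>2"
    by (metis complex_norm_square mult.commute of_real_power)
  ultimately show ?thesis
    by (simp add: phase_column_def matrix_vector_mult_axis t_def[symmetric] power2_eq_square field_simps)
qed

lemma herm_phase_column_self:
  assumes g: "g \<in> carrier SU"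
  shows "herm (phase_column g) (phase_column g) = -1"
proof -
  define c where "c = cnj (g $ None $ None) / of_real (norm (g $ None $ None))"
  have "norm (g $ None $ None) \<noteq> 0"
    using SU_corner_ge_1[OF g] by linarith
  then have "norm c = 1"
    by (simp add: c_def norm_divide)
  then have "c * cnj c = 1"
    by (metis complex_norm_square of_real_1 power_one)
  moreover have "herm (phase_column g) (phase_column g) = (c * cnj c) * -1"
    unfolding phase_column_def c_def[symmetric] herm_sesquilinear SU_last_column[OF g] by simp
  ultimately show ?thesis
    by simp
qed

text \<open>On the hyperboloid the positive last coordinate is \<open>sqrt (1 + a\<^sup>2)\<close>
  for spatial norm \<open>a\<close>, which is 1-Lipschitz in \<open>a\<close>.\<close>

lemma hyperboloid_last_close:
  assumes w: "herm w w = -1" "w $ None = of_real t" "t \<ge> 0"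
    and w': "herm w' w' = -1" "w' $ None = of_real t'" "t' \<ge> 0"
    and c: "spatial_norm (w - w') \<le> c"
  shows "norm ((w - w') $ None) \<le> c"
proof -
  define a b where "a = spatial_norm w" and "b = spatial_norm w'"
  have t: "t\<^sup>2 = a\<^sup>2 + 1" "a \<le> t" "1 \<le> t"
    using herm_negative_spatial[OF w(1)] hyperboloid_bounds[OF w(1)] w by (auto simp: a_def)
  have t': "t'\<^sup>2 = b\<^sup>2 + 1" "b \<le> t'" "1 \<le> t'"
    using herm_negative_spatial[OF w'(1)] hyperboloid_bounds[OF w'(1)] w' by (auto simp: b_def)
  have ab: "\<bar>a - b\<bar> \<le> c"
    using spatial_norm_triangle[of "w - w'" w'] spatial_norm_triangle[of "w' - w" w] c
    by (simp add: a_def b_def spatial_norm_minus[of w' w])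
  have ab0: "a \<ge> 0" "b \<ge> 0"
    by (simp_all add: a_def b_def)
  have "(t - t') * (t + t') = (a - b) * (a + b)"
    using t(1) t'(1) by (simp add: power2_eq_square algebra_simps)
  then have "\<bar>t - t'\<bar> * \<bar>t + t'\<bar> = \<bar>a - b\<bar> * \<bar>a + b\<bar>"
    by (metis abs_mult)
  also have "\<dots> \<le> c * \<bar>t + t'\<bar>"
    using ab ab0 t t' by (intro mult_mono) auto
  finally have "\<bar>t - t'\<bar> \<le> c"
    using t t' by simp
  then show ?thesis
    by (simp add: w w' flip: of_real_diff)
qed

lemma norm_herm_le_close:
  assumes "spatial_norm d \<le> c" "norm (d $ None) \<le> c" "spatial_norm e \<le> c'" "norm (e $ None) \<le> c'"
  shows "norm (herm d e) \<le> 2 * c * c'"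
proof -
  have "0 \<le> c"
    using assms(2) norm_ge_zero order_trans by blast
  then have "spatial_norm d * spatial_norm e + norm (d $ None) * norm (e $ None) \<le> c * c' + c * c'"
    using assms by (intro add_mono mult_mono) auto
  then show ?thesis
    using norm_herm_le[of d e] by simp
qed

lemma floor_eq_imp_close: "\<lfloor>x :: real\<rfloor> = \<lfloor>y\<rfloor> \<Longrightarrow> \<bar>x - y\<bar> \<le> 1"
  by linarith

lemma spatial_norm_floor_eq:
  fixes w w' :: "complex ^ 'n::finite option"
  assumes "\<And>j. \<lfloor>Re (w $ Some j)\<rfloor> = \<lfloor>Re (w' $ Some j)\<rfloor>" "\<And>j. \<lfloor>Im (w $ Some j)\<rfloor> = \<lfloor>Im (w' $ Some j)\<rfloor>"
  shows "spatial_norm (w - w') \<le> 2 * real CARD('n)"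
proof -
  have "spatial_norm (w - w') \<le> (\<Sum>j\<in>UNIV. norm ((w - w') $ Some j))"
    unfolding spatial_norm_def by (rule L2_set_le_sum) simp
  also have "\<dots> \<le> (\<Sum>j\<in>(UNIV :: 'n set). 2)"
  proof (rule sum_mono)
    fix j
    show "norm ((w - w') $ Some j) \<le> 2"
      using cmod_le[of "(w - w') $ Some j"] floor_eq_imp_close[OF assms(1)[of j]]
        floor_eq_imp_close[OF assms(2)[of j]] by simp
  qed
  finally show ?thesis
    by simp
qed

text \<open>Only the imaginary part of \<open>\<langle>w, w'\<rangle>\<close> can be large when \<open>w\<close> and \<open>w'\<close> are at bounded Euclidean
  distance, and up to a bounded error it is the difference of the values
  \<open>Im \<langle>w, w\<^sub>0\<rangle>\<close> and \<open>Im \<langle>w', w\<^sub>0\<rangle>\<close> for any \<open>w\<^sub>0\<close> near both.\<close>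

lemma norm_herm_close:
  assumes w: "herm w w = -1" "herm w' w' = -1"
    and d: "spatial_norm (w - w') \<le> c" "norm ((w - w') $ None) \<le> c"
    and d1: "spatial_norm (w - w0) \<le> c" "norm ((w - w0) $ None) \<le> c"
    and d2: "spatial_norm (w' - w0) \<le> c" "norm ((w' - w0) $ None) \<le> c"
    and Im: "\<bar>Im (herm w w0) - Im (herm w' w0)\<bar> \<le> 1"
  shows "norm (herm w w') \<le> 2 + 3 * c\<^sup>2"
proof -
  \<comment> \<open>The real part is determined by the difference vector, which is short.\<close>
  have "herm (w - w') (w - w') = -2 - (herm w w' + cnj (herm w w'))"
    using herm_commute[of w' w] by (simp add: herm_sesquilinear w)
  then have "Re (herm (w - w') (w - w')) = -2 - 2 * Re (herm w w')"
    by simp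
  moreover have "\<bar>Re (herm (w - w') (w - w'))\<bar> \<le> 2 * c * c"
    by (rule order_trans[OF abs_Re_le_cmod norm_herm_le_close[OF d d]])
  ultimately have Re: "\<bar>Re (herm w w')\<bar> \<le> 1 + c\<^sup>2"
    by (simp add: power2_eq_square)
  have "herm (w - w0) (w' - w0) = herm w w' - herm w w0 - cnj (herm w' w0) + herm w0 w0"
    using herm_commute[of w0 w'] by (simp add: herm_sesquilinear)
  then have "Im (herm (w - w0) (w' - w0)) = Im (herm w w') - (Im (herm w w0) - Im (herm w' w0))"
    by (simp add: herm_self_real)
  moreover have "\<bar>Im (herm (w - w0) (w' - w0))\<bar> \<le> 2 * c * c"
    by (rule order_trans[OF abs_Im_le_cmod norm_herm_le_close[OF d1 d2]])
  ultimately have "\<bar>Im (herm w w')\<bar> \<le> 1 + 2 * c\<^sup>2"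
    using Im by (simp add: power2_eq_square)
  with Re show ?thesis
    using cmod_le[of "herm w w'"] by simp
qed

lemma card_int_interval_le:
  assumes "\<rho> \<ge> 0"
  shows "real (card {- \<lceil>\<rho>\<rceil>..\<lceil>\<rho>\<rceil>}) \<le> 2 * \<rho> + 3"
proof -
  have "real (card {- \<lceil>\<rho>\<rceil>..\<lceil>\<rho>\<rceil>}) = 2 * real_of_int \<lceil>\<rho>\<rceil> + 1"
    using assms by simp
  then show ?thesis
    by linarith
qed

lemma floor_mem_interval: "\<bar>x :: real\<bar> \<le> \<rho> \<Longrightarrow> \<lfloor>x\<rfloor> \<in> {- \<lceil>\<rho>\<rceil>..\<lceil>\<rho>\<rceil>}"
  by (simp; linarith)

text \<open>The vectors in \<open>phase_column ` S\<close> lie on \<open>\<langle>w, w\<rangle> = -1\<close>, \<open>w\<^sub>n\<^sub>+\<^sub>1 > 0\<close>.  Sort them into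
  Euclidean unit cubes, and each cube by \<open>Im \<langle>w, w\<^sub>0\<rangle>\<close> for a base point \<open>w\<^sub>0\<close> of the cube.  There are
  \<open>O(\<rho>\<^sup>2\<^sup>n)\<close> cubes and \<open>O(\<rho>)\<close> values in each, and elements \<open>g, h\<close> of one class have \<open>g\<^sup>-\<^sup>1h\<close> in
  a fixed finite set.\<close>

lemma corner_count:
  fixes \<Gamma> :: "(complex ^ 'n::finite option ^ 'n option) set"
  assumes sub: "subgroup \<Gamma> SU" and disc: "discrete \<Gamma>"
  obtains C where "C \<ge> 0"
    "\<And>\<rho>. \<rho> \<ge> 1 \<Longrightarrow> real (card {g \<in> \<Gamma>. norm (g $ None $ None) \<le> \<rho>}) \<le> C * \<rho> ^ (2 * CARD('n) + 1)"
proof -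
  define n where "n = CARD('n)"
  define c where "c = 2 * real n"
  \<comment> \<open>The bound of \<open>norm_herm_close\<close>, with \<open>c\<close> bounding
    distances within one cube.\<close>
  define K where "K = 2 + 3 * c\<^sup>2"
  define T where "T = {g \<in> \<Gamma>. norm (g $ None $ None) \<le> K}"
  have T: "finite T"
    unfolding T_def by (rule discrete_subgroup_finite[OF sub disc])
  have SU: "g \<in> carrier SU" if "g \<in> \<Gamma>" for g
    using subgroup.mem_carrier[OF sub that] .
  have c0: "c \<ge> 0"
    by (simp add: c_def)
  \<comment> \<open>Each complex coordinate admits at most
    \<open>(5 * \<rho>) * (5 * \<rho>)\<close> cubes, each cube at most
    \<open>(4 * c + 3) * \<rho>\<close> values of the imaginary part, and each class at most
    \<open>card T\<close> elements.\<close>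
  have "real (card {g \<in> \<Gamma>. norm (g $ None $ None) \<le> \<rho>})
      \<le> (real (card T) * 25 ^ n * (4 * c + 3)) * \<rho> ^ (2 * n + 1)" if \<rho>: "\<rho> \<ge> 1" for \<rho>
  proof -
    define S where "S = {g \<in> \<Gamma>. norm (g $ None $ None) \<le> \<rho>}"
    have S: "finite S"
      unfolding S_def by (rule discrete_subgroup_finite[OF sub disc])
    let ?W = phase_column
    have SG: "g \<in> \<Gamma>" "g \<in> carrier SU" if "g \<in> S" for g
      using that SU by (auto simp: S_def)
    have WN: "norm (?W g $ None) \<le> \<rho>" "spatial_norm (?W g) \<le> \<rho>" if "g \<in> S" for g
    proof -
      show "norm (?W g $ None) \<le> \<rho>"
        using that by (simp add: phase_column_None[OF SG(2)] S_def)
      then show "spatial_norm (?W g) \<le> \<rho>"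
        using hyperboloid_bounds(1)[OF herm_phase_column_self[OF SG(2)[OF that]]] by simp
    qed
    define i1 where "i1 g = (\<lambda>j. (\<lfloor>Re (?W g $ Some j)\<rfloor>, \<lfloor>Im (?W g $ Some j)\<rfloor>))"
      for g :: "complex ^ 'n option ^ 'n option"
    \<comment> \<open>One base point for each cube that meets \<open>S\<close>.\<close>
    define r where "r i = (SOME g. g \<in> S \<and> i1 g = i)" for i
    have r: "r (i1 g) \<in> S \<and> i1 (r (i1 g)) = i1 g" if "g \<in> S" for g
      unfolding r_def by (rule someI[of _ g]) (use that in simp)
    define i2 where "i2 g = \<lfloor>Im (herm (?W g) (?W (r (i1 g))))\<rfloor>" for g
    define f where "f g = (i1 g, i2 g)" for g
    have close: "spatial_norm (?W g - ?W h) \<le> c" "norm ((?W g - ?W h) $ None) \<le> c"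
      if "g \<in> S" "h \<in> S" "i1 g = i1 h" for g h
    proof -
      show *: "spatial_norm (?W g - ?W h) \<le> c"
        unfolding c_def n_def
        by (rule spatial_norm_floor_eq) (use fun_cong[OF that(3)] in \<open>auto simp: i1_def\<close>)
      show "norm ((?W g - ?W h) $ None) \<le> c"
        using that SG
        by (intro hyperboloid_last_close[OF _ phase_column_None _ _ phase_column_None _ *]
            herm_phase_column_self) auto
    qed
    define A where "A = {- \<lceil>\<rho>\<rceil>..\<lceil>\<rho>\<rceil>}"
    define B where "B = {- \<lceil>2 * c * \<rho>\<rceil>..\<lceil>2 * c * \<rho>\<rceil>}"
    have fS: "f ` S \<subseteq> PiE UNIV (\<lambda>_ :: 'n. A \<times> A) \<times> B"
    proof (rule image_subsetI)
      fix g assume g: "g \<in> S"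
      have "norm (?W g $ Some j) \<le> \<rho>" for j
        using spatial_norm_component[of "?W g" j] WN(2)[OF g] by simp
      then have "\<bar>Re (?W g $ Some j)\<bar> \<le> \<rho>" "\<bar>Im (?W g $ Some j)\<bar> \<le> \<rho>" for j
        using abs_Re_le_cmod abs_Im_le_cmod order_trans by blast+
      then have 1: "i1 g \<in> PiE UNIV (\<lambda>_. A \<times> A)"
        unfolding i1_def A_def using floor_mem_interval by (auto simp del: atLeastAtMost_iff)
      define h where "h = r (i1 g)"
      have h: "h \<in> S" "i1 g = i1 h"
        using r[OF g] by (auto simp: h_def)
      \<comment> \<open>Subtracting the real number \<open>herm (?W h) (?W h)\<close> replaces one
        long vector by a difference of length \<open>O(1)\<close>, so the range is linear in
        \<open>\<rho>\<close> instead of quadratic.\<close>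
      have "Im (herm (?W g) (?W h)) = Im (herm (?W g - ?W h) (?W h))"
        by (simp add: herm_sesquilinear herm_self_real)
      also have "\<bar>\<dots>\<bar> \<le> 2 * c * \<rho>"
        by (rule order_trans[OF abs_Im_le_cmod norm_herm_le_close])
          (use close[OF g h] WN[OF h(1)] in auto)
      finally have "i2 g \<in> B"
        unfolding i2_def h_def[symmetric] B_def by (rule floor_mem_interval)
      with 1 show "f g \<in> PiE UNIV (\<lambda>_. A \<times> A) \<times> B"
        by (simp add: f_def)
    qed
    have "card S = (\<Sum>g\<in>S. 1)"
      by simp
    also have "\<dots> = (\<Sum>y\<in>f ` S. \<Sum>g\<in>{g \<in> S. f g = y}. 1)"
      by (rule sum.image_gen[OF S])
    also have "\<dots> \<le> (\<Sum>y\<in>f ` S. card T)"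
    proof (rule sum_mono)
      fix y assume "y \<in> f ` S"
      then obtain g where g: "g \<in> S" "y = f g"
        by blast
      have "card {h \<in> S. f h = f g} \<le> card T"
      proof (rule card_inj_on_le[of "\<lambda>h. inv\<^bsub>SU\<^esub> g ** h"])
        show "inj_on (\<lambda>h. inv\<^bsub>SU\<^esub> g ** h) {h \<in> S. f h = f g}"
          by (rule inj_on_inverseI[of _ "\<lambda>h. g ** h"])
             (simp add: matrix_mul_assoc SU_mult_inv[OF SG(2)[OF g(1)]])
        show "(\<lambda>h. inv\<^bsub>SU\<^esub> g ** h) ` {h \<in> S. f h = f g} \<subseteq> T"
        proof (rule image_subsetI)
          fix h assume "h \<in> {h \<in> S. f h = f g}"
          then have h: "h \<in> S" "i1 h = i1 g" "i2 h = i2 g"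
            by (auto simp: f_def)
          define w0 where "w0 = r (i1 g)"
          have w0: "w0 \<in> S" "i1 g = i1 w0" "i1 h = i1 w0"
            using r[OF g(1)] h by (auto simp: w0_def)
          have "norm (herm (?W g) (?W h)) \<le> K"
            unfolding K_def
          proof (rule norm_herm_close[where ?w0.0 = "?W w0"])
            show "\<bar>Im (herm (?W g) (?W w0)) - Im (herm (?W h) (?W w0))\<bar> \<le> 1"
              by (rule floor_eq_imp_close) (use h in \<open>simp add: i2_def w0_def\<close>)
          qed (use herm_phase_column_self SG g h w0 close in auto)
          then have "norm ((inv\<^bsub>SU\<^esub> g ** h) $ None $ None) \<le> K"
            by (simp add: norm_herm_phase_column[OF SG(2) SG(2)] g h)
          moreover have "inv\<^bsub>SU\<^esub> g ** h \<in> \<Gamma>"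
            using subgroup.m_closed[OF sub subgroup.m_inv_closed[OF sub]] SG g(1) h(1)
            by (metis SU_mult)
          ultimately show "inv\<^bsub>SU\<^esub> g ** h \<in> T"
            by (simp add: T_def)
        qed
      qed (rule T)
      then show "(\<Sum>g\<in>{g \<in> S. f g = y}. 1) \<le> card T"
        by (simp add: g)
    qed
    also have "\<dots> = card (f ` S) * card T"
      by simp
    also have "card (f ` S) \<le> card (PiE UNIV (\<lambda>_ :: 'n. A \<times> A) \<times> B)"
      by (rule card_mono[OF _ fS]) (auto simp: A_def B_def intro!: finite_PiE)
    also have "card (PiE UNIV (\<lambda>_ :: 'n. A \<times> A) \<times> B) = (card A * card A) ^ n * card B"
      by (simp add: card_cartesian_product card_PiE n_def)
    finally have "real (card S) \<le> real ((card A * card A) ^ n * card B * card T)"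
      unfolding of_nat_le_iff by simp
    also have "\<dots> = (real (card A) * real (card A)) ^ n * real (card B) * real (card T)"
      by simp
    also have "\<dots> \<le> ((5 * \<rho>) * (5 * \<rho>)) ^ n * ((4 * c + 3) * \<rho>) * real (card T)"
    proof -
      have A: "real (card A) \<le> 5 * \<rho>"
        using card_int_interval_le[of \<rho>] \<rho> by (simp add: A_def)
      have "real (card B) \<le> 2 * (2 * c * \<rho>) + 3"
        unfolding B_def by (rule card_int_interval_le) (use c0 \<rho> in simp)
      also have "\<dots> \<le> (4 * c + 3) * \<rho>"
        using c0 \<rho> by (simp add: algebra_simps)
      finally have B: "real (card B) \<le> (4 * c + 3) * \<rho>" .
      show ?thesis
        using A B c0 \<rho> by (intro mult_mono power_mono) auto
    qed
    also have "\<dots> = (real (card T) * 25 ^ n * (4 * c + 3)) * \<rho> ^ (2 * n + 1)"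
      by (simp add: power_mult_distrib power_add power_mult power2_eq_square flip: power_mult_distrib[of 5])
    finally show ?thesis
      by (simp add: S_def)
  qed
  moreover have "real (card T) * 25 ^ n * (4 * c + 3) \<ge> 0"
    using c0 by simp
  ultimately show ?thesis
    using that by (simp add: n_def)
qed

text \<open>Dyadic shells: the shell with corner between \<open>2 ^ i\<close> and
  \<open>2 ^ (i + 1)\<close> has \<open>O(2 ^ (i * (2 * n + 1)))\<close> elements, each contributing
  at most \<open>1 / 2 ^ (i * (2 * n + 2))\<close>. The one spare power leaves a geometric
  series.\<close>

lemma corner_summable:
  fixes \<Gamma> :: "(complex ^ 'n::finite option ^ 'n option) set"
  assumes sub: "subgroup \<Gamma> SU" and disc: "discrete \<Gamma>"
  shows "(\<lambda>g. 1 / norm (g $ None $ None) ^ (2 * CARD('n) + 2)) summable_on \<Gamma>"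
proof -
  define n where "n = CARD('n)"
  obtain C where C: "C \<ge> 0"
    "\<And>\<rho>. \<rho> \<ge> 1 \<Longrightarrow> real (card {g \<in> \<Gamma>. norm (g $ None $ None) \<le> \<rho>}) \<le> C * \<rho> ^ (2 * n + 1)"
    using corner_count[OF sub disc, folded n_def] by blast
  let ?a = "\<lambda>g :: complex ^ 'n option ^ 'n option. norm (g $ None $ None)"
  define j where "j g = nat \<lfloor>log 2 (?a g)\<rfloor>" for g
  have j: "2 ^ j g \<le> ?a g" "?a g \<le> 2 ^ (j g + 1)" if "g \<in> \<Gamma>" for g
  proof -
    have a1: "1 \<le> ?a g"
      using SU_corner_ge_1 subgroup.mem_carrier[OF sub that] by blast
    then have "0 \<le> log 2 (?a g)"
      by (subst zero_le_log_cancel_iff) auto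
    then have "0 \<le> \<lfloor>log 2 (?a g)\<rfloor>"
      by simp
    then have "real (j g) = of_int \<lfloor>log 2 (?a g)\<rfloor>"
      unfolding j_def by simp
    then have "real (j g) \<le> log 2 (?a g)" "log 2 (?a g) \<le> real (j g + 1)"
      by linarith+
    then have "2 powr real (j g) \<le> 2 powr log 2 (?a g)" "2 powr log 2 (?a g) \<le> 2 powr real (j g + 1)"
      by (simp_all only: powr_le_cancel_iff one_less_numeral_iff semiring_norm)
    moreover have "2 powr log 2 (?a g) = ?a g"
      using a1 by (intro powr_log_cancel) auto
    ultimately show "2 ^ j g \<le> ?a g" "?a g \<le> 2 ^ (j g + 1)"
      by (simp_all only: powr_realpow zero_less_numeral)
  qed
  have "sum (\<lambda>g. 1 / ?a g ^ (2 * n + 2)) F \<le> 2 * (C * 2 ^ (2 * n + 1))"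
    if F: "finite F" "F \<subseteq> \<Gamma>" for F
  proof -
    have "(\<Sum>g\<in>F. 1 / ?a g ^ (2 * n + 2)) = (\<Sum>i\<in>j ` F. \<Sum>g\<in>{g \<in> F. j g = i}. 1 / ?a g ^ (2 * n + 2))"
      by (rule sum.image_gen[OF F(1)])
    also have "\<dots> \<le> (\<Sum>i\<in>j ` F. C * 2 ^ (2 * n + 1) * (1 / 2) ^ i)"
    proof (rule sum_mono)
      fix i
      have "(\<Sum>g\<in>{g \<in> F. j g = i}. 1 / ?a g ^ (2 * n + 2))
          \<le> (\<Sum>g\<in>{g \<in> F. j g = i}. 1 / (2 ^ i) ^ (2 * n + 2))"
        using j F by (intro sum_mono frac_le power_mono) auto
      also have "\<dots> = real (card {g \<in> F. j g = i}) * (1 / (2 ^ i) ^ (2 * n + 2))"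
        by simp
      also have "\<dots> \<le> (C * (2 ^ (i + 1)) ^ (2 * n + 1)) * (1 / (2 ^ i) ^ (2 * n + 2))"
      proof (rule mult_right_mono)
        have "card {g \<in> F. j g = i} \<le> card {g \<in> \<Gamma>. ?a g \<le> 2 ^ (i + 1)}"
          using j F by (intro card_mono discrete_subgroup_finite[OF sub disc]) auto
        also have "real \<dots> \<le> C * (2 ^ (i + 1)) ^ (2 * n + 1)"
          by (rule C) (rule one_le_power, simp)
        finally show "real (card {g \<in> F. j g = i}) \<le> C * (2 ^ (i + 1)) ^ (2 * n + 1)"
          by simp
      qed simp
      also have "\<dots> = C * 2 ^ (2 * n + 1) * (1 / 2) ^ i"
        by (simp add: power_mult_distrib power_divide)
      finally show "(\<Sum>g\<in>{g \<in> F. j g = i}. 1 / ?a g ^ (2 * n + 2)) \<le> C * 2 ^ (2 * n + 1) * (1 / 2) ^ i" .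
    qed
    also have "\<dots> = C * 2 ^ (2 * n + 1) * (\<Sum>i\<in>j ` F. (1 / 2) ^ i)"
      by (simp add: sum_distrib_left)
    also have "\<dots> \<le> C * 2 ^ (2 * n + 1) * (\<Sum>i. (1 / 2) ^ i)"
      using C F by (intro mult_left_mono sum_le_suminf) auto
    also have "(\<Sum>i. (1 / 2 :: real) ^ i) = 2"
      by (subst suminf_geometric) auto
    finally show ?thesis
      by simp
  qed
  then have "(\<lambda>g. 1 / ?a g ^ (2 * n + 2)) summable_on \<Gamma>"
    by (intro nonneg_bdd_above_summable_on) (auto simp: bdd_above_def intro!: exI[of _ "2 * (C * 2 ^ (2 * n + 1))"])
  then show ?thesis
    by (simp add: n_def)
qed

section \<open>The Jacobi determinant\<close>

lemma sum_UNIV_option: "sum f (UNIV :: 'n::finite option set) = f None + (\<Sum>i\<in>UNIV. f (Some i))"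
  by (simp add: UNIV_option_conv sum.reindex)

lemma prod_UNIV_option: "prod f (UNIV :: 'n::finite option set) = f None * (\<Prod>i\<in>UNIV. f (Some i))"
  by (simp add: UNIV_option_conv prod.reindex)

lemma sign_map_option:
  fixes q :: "'n::finite \<Rightarrow> 'n"
  assumes "q permutes UNIV"
  shows "sign (map_option q) = sign q"
proof -
  have "inv_into UNIV Some (Some a) = a" for a :: 'n
    by (simp add: inv_f_f)
  then have "map_permutation UNIV Some q x = map_option q x" for x
    by (cases x) (auto simp: map_permutation_def restrict_id_def)
  then have "map_permutation UNIV Some q = map_option q"
    by blast
  then show ?thesis
    using sign_map_permutation[of Some UNIV q] assms by simp
qed

text \<open>A permutation moving \<open>None\<close> picks a zero from the column
  \<open>None\<close>. Those fixing \<open>None\<close> are the maps \<open>map_option q\<close>,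
  and \<open>map_option\<close> preserves signs.\<close>

lemma det_option_block:
  fixes A :: "'a::comm_ring_1 ^ 'n::finite option ^ 'n option"
  assumes 0: "\<And>i. A $ Some i $ None = 0"
  shows "det A = A $ None $ None * det (\<chi> i j. A $ Some i $ Some j)"
proof -
  let ?t = "\<lambda>p. of_int (sign p) * (\<Prod>i\<in>UNIV. A $ i $ p i)"
  let ?S = "{p. p permutes (UNIV :: 'n option set)}"
  have zero: "?t p = 0" if p: "p permutes UNIV" "p None \<noteq> None" for p
  proof -
    obtain x where x: "p x = None"
      using p(1) by (metis permutes_surj surj_def)
    with p(2) obtain i where "x = Some i"
      by (cases x) auto
    with x have "A $ x $ p x = 0"
      by (simp add: 0)
    then have "(\<Prod>i\<in>UNIV. A $ i $ p i) = 0"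
      by (intro prod_zero) auto
    then show ?thesis
      by simp
  qed
  have "det A = sum ?t ?S"
    by (simp add: det_def)
  also have "\<dots> = sum ?t {p \<in> ?S. p None = None}"
    using zero by (intro sum.mono_neutral_right) (auto simp: finite_permutations)
  also have "\<dots> = (\<Sum>q\<in>{q. q permutes (UNIV :: 'n set)}.
      A $ None $ None * (of_int (sign q) * (\<Prod>i\<in>UNIV. A $ Some i $ Some (q i))))"
  proof (rule sum.reindex_bij_witness[where j = "\<lambda>p x. the (p (Some x))" and i = map_option])
    fix p assume "p \<in> {p \<in> ?S. p None = None}"
    then have p: "bij p" "p None = None"
      using permutes_bij by auto
    have ps: "p (Some x) = Some (the (p (Some x)))" for x
      using p by (metis bij_is_inj injD option.exhaust_sel option.distinct(1))
    show *: "map_option (\<lambda>x. the (p (Some x))) = p"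
    proof
      fix x show "map_option (\<lambda>x. the (p (Some x))) x = p x"
        using ps p by (cases x) auto
    qed
    have "inj (\<lambda>x. the (p (Some x)))"
    proof (rule injI)
      fix x y assume "the (p (Some x)) = the (p (Some y))"
      then have "p (Some x) = p (Some y)"
        using ps by metis
      then show "x = y"
        using injD[OF bij_is_inj[OF p(1)]] by blast
    qed
    then have "bij (\<lambda>x. the (p (Some x)))"
      by (simp add: bij_def finite_UNIV_inj_surj)
    then show q: "(\<lambda>x. the (p (Some x))) \<in> {q. q permutes UNIV}"
      by (simp add: permutes_altdef)
    show "A $ None $ None * (of_int (sign (\<lambda>x. the (p (Some x)))) *
        (\<Prod>i\<in>UNIV. A $ Some i $ Some (the (p (Some i))))) = ?t p"
      using sign_map_option[of "\<lambda>x. the (p (Some x))"] q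
      by (simp add: * prod_UNIV_option p ps[symmetric] mult_ac)
  next
    fix q assume "q \<in> {q. q permutes (UNIV :: 'n set)}"
    then have "bij q"
      using permutes_bij by blast
    then have "bij (map_option q)"
      by (metis bij_def finite_UNIV_inj_surj finite_class.finite_UNIV option.inj_map)
    then show "map_option q \<in> {p \<in> ?S. p None = None}"
      by (simp add: permutes_altdef)
  qed simp
  also have "\<dots> = A $ None $ None * det (\<chi> i j. A $ Some i $ Some j)"
    by (simp add: det_def sum_distrib_left)
  finally show ?thesis .
qed

lemma lift_nth [simp]: "lift z $ None = 1" "lift z $ Some j = z $ j"
  by (simp_all add: lift_def)

lemma lift_update:
  "lift (\<chi> k. if k = j then t else z $ k) = lift z + (t - z $ j) *s axis (Some j) 1"
  by (rule vec_option_eqI) (auto simp: axis_def)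

lemma mult_lift_update:
  "(g *v lift (\<chi> k. if k = j then t else z $ k)) $ r = (g *v lift z) $ r + g $ r $ Some j * (t - z $ j)"
  unfolding lift_update matrix_vector_right_distrib vector_scalar_commute
  by (simp only: vector_add_component vector_smult_component matrix_vector_mult_axis mult.commute)

text \<open>Along a coordinate line numerator and denominator of the action are affine in
  \<open>t\<close>, so the quotient rule gives the entry.\<close>

lemma jacobi_entry:
  assumes D: "(g *v lift z) $ None \<noteq> 0"
  shows "jacobi g z $ i $ j =
    (g $ Some i $ Some j * (g *v lift z) $ None - (g *v lift z) $ Some i * g $ None $ Some j)
      / ((g *v lift z) $ None)\<^sup>2"
proof -
  define N where "N = (g *v lift z) $ Some i"
  define d where "d = (g *v lift z) $ None"
  have "((\<lambda>t. (N + g $ Some i $ Some j * (t - z $ j)) / (d + g $ None $ Some j * (t - z $ j)))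
      has_field_derivative (g $ Some i $ Some j * d - N * g $ None $ Some j) / d\<^sup>2) (at (z $ j))"
    using D by (auto intro!: derivative_eq_intros simp: d_def power2_eq_square)
  then have "deriv (\<lambda>t. act g (\<chi> k. if k = j then t else z $ k) $ i) (z $ j) =
      (g $ Some i $ Some j * d - N * g $ None $ Some j) / d\<^sup>2"
    unfolding act_def by (simp add: mult_lift_update N_def d_def DERIV_imp_deriv)
  then show ?thesis
    by (simp add: jacobi_def N_def d_def)
qed

text \<open>Multiplying \<open>g\<close> on the right by the matrix with last column \<open>lift z\<close> and subtracting
  multiples of the last row leaves a block triangular matrix, whose upper left block is
  \<open>(g *v lift z) $ None\<close> times the Jacobi matrix.\<close>

lemma det_jacobi:
  fixes g :: "complex ^ 'n::finite option ^ 'n option"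
  assumes g: "det g = 1" and D: "(g *v lift z) $ None \<noteq> 0"
  shows "det (jacobi g z) = 1 / ((g *v lift z) $ None) ^ (CARD('n) + 1)"
proof -
  define d where "d = (g *v lift z) $ None"
  define N where "N i = (g *v lift z) $ Some i" for i
  define M where "M = (\<chi> i j. g $ Some i $ Some j - N i / d * g $ None $ Some j)"
  have d: "d \<noteq> 0"
    using D by (simp add: d_def)
  define R where "R = (\<chi> i j. if j = None then lift z $ i else if i = j then 1 else 0)"
  define L where "L = (\<chi> i j. if i = j then 1 else if j = None then - (g *v lift z) $ i / d else 0)"
  \<comment> \<open>Both auxiliary matrices have the unit row at \<open>None\<close>, so the block
    formula applies to their transposes.\<close>
  have unipotent: "det T = 1" if "\<And>j. T $ None $ Some j = 0" "T $ None $ None = 1"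
    "\<And>i j. T $ Some i $ Some j = (if i = j then 1 else 0)" for T :: "complex ^ 'n option ^ 'n option"
  proof -
    have "(\<chi> i j. transpose T $ Some i $ Some j) = (mat 1 :: complex ^ 'n ^ 'n)"
      by (auto simp: vec_eq_iff transpose_def mat_def that)
    then have "det (transpose T) = 1"
      by (subst det_option_block) (simp_all add: that, simp_all add: transpose_def that)
    then show ?thesis
      by simp
  qed
  have "det R = 1" "det L = 1"
    by (rule unipotent; simp add: R_def L_def)+
  then have "det (L ** (g ** R)) = 1"
    by (simp add: det_mul g)
  have gR_None: "(g ** R) $ i $ None = (g *v lift z) $ i" for i
    by (simp add: matrix_matrix_mult_def matrix_vector_mult_def R_def)
  have gR_Some: "(g ** R) $ i $ Some j = g $ i $ Some j" for i j
    by (simp add: matrix_matrix_mult_def R_def if_distrib[of "\<lambda>x. _ * x"] cong: if_cong)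
  have L_Some: "(L ** T) $ Some i $ j = T $ Some i $ j - N i / d * T $ None $ j" for T i j
  proof -
    have "(\<Sum>k\<in>UNIV. L $ Some i $ Some k * T $ Some k $ j)
        = (\<Sum>k\<in>UNIV. if i = k then T $ Some k $ j else 0)"
      by (intro sum.cong) (auto simp: L_def)
    then have "(L ** T) $ Some i $ j = L $ Some i $ None * T $ None $ j + T $ Some i $ j"
      by (simp add: matrix_matrix_mult_def sum_UNIV_option)
    then show ?thesis
      by (simp add: L_def N_def)
  qed
  have L_None: "(L ** T) $ None $ j = T $ None $ j" for T j
    by (simp add: matrix_matrix_mult_def sum_UNIV_option L_def)
  have "det (L ** (g ** R)) = (L ** (g ** R)) $ None $ None * det (\<chi> i j. (L ** (g ** R)) $ Some i $ Some j)"
    by (rule det_option_block) (use d in \<open>simp add: L_Some gR_None N_def d_def\<close>)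
  also have "\<dots> = d * det M"
    by (simp add: L_Some L_None gR_None gR_Some d_def[symmetric] M_def)
  finally have dM: "d * det M = 1"
    using \<open>det (L ** (g ** R)) = 1\<close> by simp
  have "jacobi g z = (\<chi> i. (1 / d) *s (M $ i))"
    using d by (simp add: vec_eq_iff jacobi_entry[OF D] M_def d_def[symmetric] N_def[symmetric]
        power2_eq_square field_simps)
  \<comment> \<open>Each of the \<open>n\<close> rows contributes a factor \<open>1 / d\<close>; the
    remaining one comes from \<open>dM\<close>.\<close>
  also have "det \<dots> = (1 / d) ^ CARD('n) * det M"
    by (subst det_rows_mul) simp
  also have "\<dots> = 1 / d ^ (CARD('n) + 1)"
    using d dM by (simp add: field_simps)
  finally show ?thesis
    by (simp add: d_def)
qed

section \<open>Series of holomorphic functions\<close>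

lemma holo_on_const: "(\<lambda>z. a) holo_on U"
  unfolding holo_on_def by (auto intro!: exI[of _ "\<lambda>h. 0"])

lemma holo_on_mult:
  assumes "f holo_on U" "g holo_on U"
  shows "(\<lambda>z. f z * g z) holo_on U"
  unfolding holo_on_def
proof
  fix z assume "z \<in> U"
  then obtain D E where D: "(f has_derivative D) (at z)" "\<And>c v. D (c *s v) = c * D v"
    and E: "(g has_derivative E) (at z)" "\<And>c v. E (c *s v) = c * E v"
    using assms unfolding holo_on_def by metis
  have "((\<lambda>z. f z * g z) has_derivative (\<lambda>h. f z * E h + D h * g z)) (at z)"
    by (rule has_derivative_mult[OF D(1) E(1)])
  moreover have "f z * E (c *s v) + D (c *s v) * g z = c * (f z * E v + D v * g z)" for c v
    by (simp add: D E algebra_simps)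
  ultimately show "\<exists>D. ((\<lambda>z. f z * g z) has_derivative D) (at z) \<and> (\<forall>c v. D (c *s v) = c * D v)"
    by blast
qed

lemma holo_on_power: "f holo_on U \<Longrightarrow> (\<lambda>z. f z ^ n) holo_on U"
  by (induction n) (auto intro: holo_on_const holo_on_mult)

lemma holo_on_prod: "(\<And>i. i \<in> I \<Longrightarrow> f i holo_on U) \<Longrightarrow> (\<lambda>z. \<Prod>i\<in>I. f i z) holo_on U"
  by (induction I rule: infinite_finite_induct) (auto intro: holo_on_const holo_on_mult)

lemma holo_on_inverse:
  assumes "f holo_on U" "\<And>z. z \<in> U \<Longrightarrow> f z \<noteq> 0"
  shows "(\<lambda>z. inverse (f z)) holo_on U"
  unfolding holo_on_def
proof
  fix z assume z: "z \<in> U"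
  then obtain D where D: "(f has_derivative D) (at z)" "\<And>c v. D (c *s v) = c * D v"
    using assms unfolding holo_on_def by metis
  have "((\<lambda>z. inverse (f z)) has_derivative (\<lambda>h. - (inverse (f z) * D h * inverse (f z)))) (at z)"
    by (rule Deriv.has_derivative_inverse[OF assms(2)[OF z] D(1)])
  moreover have "- (inverse (f z) * D (c *s v) * inverse (f z)) = c * - (inverse (f z) * D v * inverse (f z))" for c v
    by (simp add: D algebra_simps)
  ultimately show "\<exists>D. ((\<lambda>z. inverse (f z)) has_derivative D) (at z) \<and> (\<forall>c v. D (c *s v) = c * D v)"
    by blast
qed

lemma holo_on_herm_lift: "(\<lambda>z. herm (lift z) w) holo_on U"
  unfolding holo_on_def
proof
  fix z
  have "((\<lambda>z. (\<Sum>j\<in>UNIV. z $ j * cnj (w $ Some j)) - cnj (w $ None)) has_derivative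
      (\<lambda>h. \<Sum>j\<in>UNIV. h $ j * cnj (w $ Some j))) (at z)"
    by (auto intro!: derivative_eq_intros bounded_linear.has_derivative[OF bounded_linear_vec_nth])
  moreover have "(\<lambda>z. herm (lift z) w) = (\<lambda>z. (\<Sum>j\<in>UNIV. z $ j * cnj (w $ Some j)) - cnj (w $ None))"
    by (simp add: herm_def)
  moreover have "(\<Sum>j\<in>UNIV. (c *s h) $ j * cnj (w $ Some j)) = c * (\<Sum>j\<in>UNIV. h $ j * cnj (w $ Some j))"
    for c and h :: "complex ^ 'a"
    by (simp add: sum_distrib_left mult.assoc)
  ultimately show "\<exists>D. ((\<lambda>z. herm (lift z) w) has_derivative D) (at z) \<and> (\<forall>c v. D (c *s v) = c * D v)"
    by (intro exI[of _ "\<lambda>h. \<Sum>j\<in>UNIV. h $ j * cnj (w $ Some j)"]) simp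
qed

section \<open>Cauchy estimates and termwise differentiation\<close>

lemma norm_vec_scale: "norm (c *s (x :: complex ^ 'n::finite)) = norm c * norm x"
  by (simp add: norm_vec_def norm_mult L2_set_right_distrib)

lemma vec_scale_of_real: "complex_of_real c *s x = c *\<^sub>R x"
  by (simp add: vec_eq_iff) (simp add: scaleR_conv_of_real)

text \<open>Restricting \<open>f\<close> to the complex line through \<open>z\<close> in direction
  \<open>h\<close> gives a function of one variable, to which Cauchy's inequality applies. The disc
  has radius \<open>r / 2\<close> so that its closure stays inside the ball, whence the factor
  2.\<close>

lemma holo_derivative_bound:
  fixes z :: "complex ^ 'n::finite"
  assumes f: "f holo_on ball z r" and "r > 0" and B: "\<And>w. w \<in> ball z r \<Longrightarrow> norm (f w) \<le> B"
    and D: "(f has_derivative D) (at z)" "\<And>c v. D (c *s v) = c * D v"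
  shows "norm (D h) \<le> 2 * B / r * norm h"
proof (cases "h = 0")
  case True
  then show ?thesis
    using D(2)[of 0 0] by simp
next
  case False
  define u where "u = complex_of_real (inverse (norm h)) *s h"
  have u: "norm u = 1"
    using False by (simp add: u_def norm_vec_scale norm_inverse)
  have mem: "z + t *s u \<in> ball z r" if "norm t < r" for t
    using that by (simp add: dist_norm norm_vec_scale u)
  have lin: "((\<lambda>t. z + t *s u) has_derivative (\<lambda>s. s *s u)) (at t)" for t
  proof -
    have "bounded_linear (\<lambda>s. s *s u)"
      by (rule bounded_linear_intro[where K = 1]; simp add: vec_eq_iff norm_vec_scale u; simp add: algebra_simps)
    then show ?thesis
      using has_derivative_add[OF has_derivative_const[of z] bounded_linear_imp_has_derivative] by simp
  qed
  have deriv: "((\<lambda>t. f (z + t *s u)) has_field_derivative E u) (at t)"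
    if "(f has_derivative E) (at (z + t *s u))" "\<And>c v. E (c *s v) = c * E v" for t E
  proof -
    have "((\<lambda>t. f (z + t *s u)) has_derivative (\<lambda>s. E (s *s u))) (at t)"
      using has_derivative_compose[OF lin that(1)] by simp
    then show ?thesis
      by (simp add: has_field_derivative_def that(2) mult.commute[of _ "E u"])
  qed
  have field_diff: "(\<lambda>t. f (z + t *s u)) field_differentiable at t" if "norm t < r" for t
  proof -
    note mem[OF that]
    then obtain E where "(f has_derivative E) (at (z + t *s u))" "\<And>c v. E (c *s v) = c * E v"
      using f unfolding holo_on_def by blast
    from deriv[OF this] show ?thesis
      unfolding field_differentiable_def by blast
  qed
  define \<phi> where "\<phi> = (\<lambda>t. f (z + t *s u))"
  have r2: "norm t < r" if "t \<in> cball 0 (r / 2)" for t :: complex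
    using that \<open>r > 0\<close> by simp
  have fd: "\<phi> field_differentiable at t" if "t \<in> cball 0 (r / 2)" for t
    unfolding \<phi>_def by (rule field_diff[OF r2[OF that]])
  have "norm ((deriv ^^ 1) \<phi> 0) \<le> fact 1 * B / (r / 2) ^ 1"
  proof (rule Cauchy_inequality)
    show "\<phi> holomorphic_on ball 0 (r / 2)"
      unfolding holomorphic_on_def
      by (rule ballI, rule field_differentiable_at_within, rule fd) simp
    show "continuous_on (cball 0 (r / 2)) \<phi>"
      by (intro continuous_at_imp_continuous_on ballI field_differentiable_imp_continuous_at fd)
    show "0 < r / 2"
      using \<open>r > 0\<close> by simp
    show "norm (\<phi> t) \<le> B" if "norm (0 - t) = r / 2" for t
      unfolding \<phi>_def by (intro B mem r2) (use that in simp)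
  qed
  moreover have "deriv \<phi> 0 = D u"
    unfolding \<phi>_def by (rule DERIV_imp_deriv, rule deriv) (use D in simp_all)
  ultimately have Du: "norm (D u) \<le> 2 * B / r"
    by (simp add: mult.commute)
  have "h = of_real (norm h) *s u"
    using False by (simp add: u_def vec_eq_iff)
  then have "D h = of_real (norm h) * D u"
    by (metis D(2))
  then have "norm (D h) = norm h * norm (D u)"
    by (simp add: norm_mult)
  also have "\<dots> \<le> norm h * (2 * B / r)"
    by (intro mult_left_mono Du) simp
  finally show ?thesis
    by (simp add: mult.commute)
qed

lemma summable_on_tail_le:
  fixes M :: "'a \<Rightarrow> real"
  assumes "M summable_on I" "\<And>i. i \<in> I \<Longrightarrow> 0 \<le> M i" "\<epsilon> > 0"
  obtains F where "finite F" "F \<subseteq> I" "infsum M (I - F) < \<epsilon>"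
proof -
  have "(M has_sum infsum M I) I"
    using assms(1) by (rule has_sum_infsum)
  then have "\<forall>\<^sub>F F in finite_subsets_at_top I. dist (sum M F) (infsum M I) < \<epsilon>"
    unfolding has_sum_def using assms(3) by (rule tendstoD)
  then obtain F where F: "finite F" "F \<subseteq> I" "dist (sum M F) (infsum M I) < \<epsilon>"
    unfolding eventually_finite_subsets_at_top by blast
  have "infsum M (I - F) = infsum M I - infsum M F"
    by (rule infsum_Diff[OF assms(1) summable_on_finite[OF F(1)] F(2)])
  with F that show ?thesis
    by (simp add: dist_real_def)
qed

text \<open>The derivatives of the terms inherit the majorant from the terms by Cauchy's inequality on
  complex lines, so the tail of the difference quotient is small uniformly.\<close>

lemma holo_on_infsum_at:
  fixes f :: "'i \<Rightarrow> complex ^ 'n::finite \<Rightarrow> complex"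
  assumes f: "\<And>i. i \<in> I \<Longrightarrow> f i holo_on ball z r" and r: "r > 0"
    and M: "\<And>i w. i \<in> I \<Longrightarrow> w \<in> ball z r \<Longrightarrow> norm (f i w) \<le> M i" and sum_M: "M summable_on I"
  obtains D where "((\<lambda>w. \<Sum>\<^sub>\<infinity>i\<in>I. f i w) has_derivative D) (at z)" "\<And>c v. D (c *s v) = c * D v"
proof -
  \<comment> \<open>Each point of \<open>ball z (r / 2)\<close> has a ball of radius
    \<open>r / 2\<close> on which \<open>M i\<close> bounds the term, so Cauchy's estimate there
    gives \<open>2 * M i / (r / 2)\<close>.\<close>
  define N where "N i = 4 * M i / r" for i
  have M0: "0 \<le> M i" if "i \<in> I" for i
    by (rule order_trans[OF norm_ge_zero M[OF that, of z]]) (use r in simp)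
  have N0: "0 \<le> N i" if "i \<in> I" for i
    using M0[OF that] r by (simp add: N_def)
  have sum_N: "N summable_on I"
    unfolding N_def using summable_on_cmult_right[OF sum_M, of "4 / r"] by simp
  define D where "D i w = (SOME D. (f i has_derivative D) (at w) \<and> (\<forall>c v. D (c *s v) = c * D v))"
    for i w
  have D: "(f i has_derivative D i w) (at w) \<and> (\<forall>c v. D i w (c *s v) = c * D i w v)"
    if "i \<in> I" "w \<in> ball z r" for i w
    unfolding D_def by (rule someI_ex[OF bspec[OF f[OF that(1), unfolded holo_on_def] that(2)]])
  have DN: "norm (D i w h) \<le> N i * norm h" if i: "i \<in> I" and w: "w \<in> ball z (r / 2)" for i w h
  proof -
    have sub: "ball w (r / 2) \<subseteq> ball z r"
    proof
      fix y assume "y \<in> ball w (r / 2)"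
      then show "y \<in> ball z r"
        using w dist_triangle[of z y w] by simp
    qed
    have wr: "w \<in> ball z r"
      using w r by simp
    have "norm (D i w h) \<le> 2 * M i / (r / 2) * norm h"
    proof (rule holo_derivative_bound)
      show "f i holo_on ball w (r / 2)"
        using f[OF i] sub unfolding holo_on_def by blast
    qed (use r sub M i D wr in auto)
    then show ?thesis
      by (simp add: N_def)
  qed
  have lip: "norm (f i y - f i z) \<le> N i * norm (y - z)" if i: "i \<in> I" and y: "y \<in> ball z (r / 2)" for i y
  proof (rule differentiable_bound[of "ball z (r / 2)" "f i" "D i"])
    fix w assume w: "w \<in> ball z (r / 2)"
    then show "(f i has_derivative D i w) (at w within ball z (r / 2))"
      using r by (intro has_derivative_at_withinI[OF conjunct1[OF D]] i) auto
    show "onorm (D i w) \<le> N i"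
      by (rule onorm_bound) (use N0 DN i w in auto)
  qed (use y r in auto)
  have z: "z \<in> ball z (r / 2)" "z \<in> ball z r"
    using r by auto
  define E where "E h = (\<Sum>\<^sub>\<infinity>i\<in>I. D i z h)" for h
  have sum_D: "(\<lambda>i. D i z h) summable_on I" for h
    by (rule abs_summable_summable, rule summable_on_comparison_test[OF summable_on_cmult_left[OF sum_N, of "norm h"]])
       (use DN z in auto)
  have sum_f: "(\<lambda>i. f i w) summable_on I" if "w \<in> ball z r" for w
    by (rule abs_summable_summable, rule summable_on_comparison_test[OF sum_M]) (use M that in auto)
  have linD: "linear (D i z)" if "i \<in> I" for i
    using D[OF that z(2)] has_derivative_linear by blast
  have E_scale: "E (c *s v) = c * E v" for c v
  proof -
    have "E (c *s v) = (\<Sum>\<^sub>\<infinity>i\<in>I. c * D i z v)"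
      unfolding E_def using D[OF _ z(2)] by (intro infsum_cong) blast
    then show ?thesis
      by (simp add: E_def infsum_cmult_right')
  qed
  have "bounded_linear E"
  proof (rule bounded_linear_intro)
    show "E (x + y) = E x + E y" for x y
      unfolding E_def by (subst infsum_add[OF sum_D sum_D, symmetric])
        (rule infsum_cong, rule linear_add[OF linD])
    show "E (s *\<^sub>R x) = s *\<^sub>R E x" for s x
      using E_scale[of "of_real s" x] by (simp add: vec_scale_of_real scaleR_conv_of_real)
    show "norm (E x) \<le> norm x * infsum N I" for x
    proof -
      have "norm (E x) \<le> (\<Sum>\<^sub>\<infinity>i\<in>I. norm x * N i)"
        unfolding E_def by (rule norm_infsum_le[OF has_sum_infsum[OF sum_D] has_sum_infsum[OF summable_on_cmult_right[OF sum_N]]])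
          (use DN z in \<open>auto simp: mult.commute\<close>)
      then show ?thesis
        by (simp add: infsum_cmult_right')
    qed
  qed
  moreover have "\<exists>d>0. \<forall>y. norm (y - z) < d \<longrightarrow>
      norm ((\<Sum>\<^sub>\<infinity>i\<in>I. f i y) - (\<Sum>\<^sub>\<infinity>i\<in>I. f i z) - E (y - z)) \<le> \<epsilon> * norm (y - z)" if "\<epsilon> > 0" for \<epsilon>
  proof -
    \<comment> \<open>The finite part contributes \<open>\<epsilon> / 2\<close>. In the tail each
      term costs \<open>N i\<close> for the difference and \<open>N i\<close> for the derivative, so
      a tail below \<open>\<epsilon> / 4\<close> contributes the other half.\<close>
    obtain F where F: "finite F" "F \<subseteq> I" "infsum N (I - F) < \<epsilon> / 4"
      using summable_on_tail_le[OF sum_N N0, of "\<epsilon> / 4"] \<open>\<epsilon> > 0\<close> by auto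
    have "((\<lambda>w. \<Sum>i\<in>F. f i w) has_derivative (\<lambda>h. \<Sum>i\<in>F. D i z h)) (at z)"
      using F D z by (intro has_derivative_sum) auto
    then obtain d where d: "d > 0" "\<And>y. norm (y - z) < d \<Longrightarrow>
        norm ((\<Sum>i\<in>F. f i y) - (\<Sum>i\<in>F. f i z) - (\<Sum>i\<in>F. D i z (y - z))) \<le> \<epsilon> / 2 * norm (y - z)"
      using \<open>\<epsilon> > 0\<close> unfolding has_derivative_at_alt by (meson half_gt_zero)
    have "norm ((\<Sum>\<^sub>\<infinity>i\<in>I. f i y) - (\<Sum>\<^sub>\<infinity>i\<in>I. f i z) - E (y - z)) \<le> \<epsilon> * norm (y - z)"
      if y: "norm (y - z) < min d (r / 2)" for y
    proof -
      define g where "g = (\<lambda>i. f i y - f i z - D i z (y - z))"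
      have y': "y \<in> ball z (r / 2)" "y \<in> ball z r"
        using y r by (auto simp: dist_norm norm_minus_commute)
      let ?\<Delta> = "(\<Sum>\<^sub>\<infinity>i\<in>I. f i y) - (\<Sum>\<^sub>\<infinity>i\<in>I. f i z) - E (y - z)"
      have "(g has_sum ?\<Delta>) I"
        using has_sum_add[OF has_sum_add[OF has_sum_infsum[OF sum_f[OF y'(2)]]
              has_sum_uminusI[OF has_sum_infsum[OF sum_f[OF z(2)]]]]
            has_sum_uminusI[OF has_sum_infsum[OF sum_D[of "y - z"]]]]
        by (simp add: g_def E_def)
      then have sum_g: "g summable_on I" and "?\<Delta> = infsum g I"
        by (auto simp: has_sum_iff)
      note this(2)
      also have "\<dots> = sum g F + infsum g (I - F)"
        using infsum_Diff[OF sum_g summable_on_finite[OF F(1)] F(2)] F(1) by simp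
      finally have eq: "?\<Delta> = sum g F + infsum g (I - F)" .
      have "norm (sum g F) \<le> \<epsilon> / 2 * norm (y - z)"
        using d(2)[of y] y by (simp add: g_def sum_subtractf)
      moreover have "norm (infsum g (I - F)) \<le> (\<Sum>\<^sub>\<infinity>i\<in>I - F. 2 * norm (y - z) * N i)"
      proof (rule norm_infsum_le[OF has_sum_infsum has_sum_infsum])
        show "g summable_on I - F"
          using sum_g by (rule summable_on_subset_banach) auto
        show "(\<lambda>i. 2 * norm (y - z) * N i) summable_on I - F"
          by (intro summable_on_cmult_right summable_on_subset_banach[OF sum_N]) auto
        show "norm (g i) \<le> 2 * norm (y - z) * N i" if "i \<in> I - F" for i
          using norm_triangle_ineq4[of "f i y - f i z" "D i z (y - z)"] lip[of i y] DN[of i z "y - z"] that y' z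
          by (simp add: g_def mult_ac)
      qed
      moreover have "(\<Sum>\<^sub>\<infinity>i\<in>I - F. 2 * norm (y - z) * N i) = 2 * norm (y - z) * infsum N (I - F)"
        by (rule infsum_cmult_right')
      moreover have "2 * norm (y - z) * infsum N (I - F) \<le> 2 * norm (y - z) * (\<epsilon> / 4)"
        using F(3) by (intro mult_left_mono) auto
      ultimately show ?thesis
        unfolding eq using norm_triangle_ineq[of "sum g F" "infsum g (I - F)"] by simp
    qed
    then show ?thesis
      using d(1) r by (intro exI[of _ "min d (r / 2)"]) auto
  qed
  ultimately have "((\<lambda>w. \<Sum>\<^sub>\<infinity>i\<in>I. f i w) has_derivative E) (at z)"
    unfolding has_derivative_at_alt by blast
  with E_scale that show ?thesis
    by blast
qed

section \<open>The relative Poincare series\<close>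

lemma holo_on_cong:
  assumes "open U" "\<And>z. z \<in> U \<Longrightarrow> f z = g z" "g holo_on U"
  shows "f holo_on U"
  unfolding holo_on_def
proof
  fix z assume z: "z \<in> U"
  then obtain D where D: "(g has_derivative D) (at z)" "\<And>c v. D (c *s v) = c * D v"
    using assms(3) unfolding holo_on_def by metis
  have "(f has_derivative D) (at z)"
    by (rule has_derivative_transform_within_open[OF D(1) assms(1) z]) (simp add: assms(2))
  with D show "\<exists>D. (f has_derivative D) (at z) \<and> (\<forall>c v. D (c *s v) = c * D v)"
    by blast
qed

section \<open>The action on lifted points of the ball\<close>

lemma spatial_norm_lift: "spatial_norm (lift z) = norm z"
  by (simp add: spatial_norm_def norm_vec_def)

lemma herm_lift_negative:
  assumes "z \<in> ball 0 1"
  shows "Re (herm (lift z) (lift z)) < 0"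
  using assms power_strict_mono[of "norm z" 1 2] by (simp add: herm_self spatial_norm_lift)

lemma mem_ball_iff_herm: "z \<in> ball 0 1 \<longleftrightarrow> Re (herm (lift z) (lift z)) < 0"
  by (simp add: herm_self spatial_norm_lift power_less_one_iff abs_square_less_1)

lemma SU_lift_None:
  assumes "g \<in> carrier SU" "z \<in> ball 0 1"
  shows "(g *v lift z) $ None \<noteq> 0"
proof
  assume "(g *v lift z) $ None = 0"
  then have "0 \<le> Re (herm (g *v lift z) (g *v lift z))"
    by (simp add: herm_self)
  then show False
    using herm_lift_negative[OF assms(2)] by (simp add: SU_herm[OF assms(1)])
qed

lemma lift_act:
  assumes "g \<in> carrier SU" "z \<in> ball 0 1"
  shows "lift (act g z) = inverse ((g *v lift z) $ None) *s (g *v lift z)"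
  using SU_lift_None[OF assms]
  by (intro vec_option_eqI) (simp_all add: act_def divide_inverse mult.commute)

lemma act_in_ball:
  assumes "g \<in> carrier SU" "z \<in> ball 0 1"
  shows "act g z \<in> ball 0 1"
proof -
  define c where "c = inverse ((g *v lift z) $ None)"
  have "herm (lift (act g z)) (lift (act g z)) = (c * cnj c) * herm (lift z) (lift z)"
    unfolding lift_act[OF assms] c_def[symmetric] herm_sesquilinear SU_herm[OF assms(1)] by simp
  also have "c * cnj c = of_real ((norm c)\<^sup>2)"
    by (rule complex_norm_square[symmetric])
  finally have "Re (herm (lift (act g z)) (lift (act g z))) = (norm c)\<^sup>2 * Re (herm (lift z) (lift z))"
    by (simp del: of_real_power)
  moreover have "norm c > 0"
    using SU_lift_None[OF assms] by (simp add: c_def)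
  ultimately show ?thesis
    unfolding mem_ball_iff_herm using herm_lift_negative[OF assms(2)] by (simp add: mult_pos_neg)
qed

lemma SU_inv_null_vec:
  assumes g: "g \<in> carrier SU" and N: "null_vec N"
  shows "null_vec (inv\<^bsub>SU\<^esub> g *v N)"
proof -
  have "g *v (inv\<^bsub>SU\<^esub> g *v N) = N"
    by (simp add: matrix_vector_mul_assoc SU_mult_inv[OF g])
  then show ?thesis
    using N by (auto simp: null_vec_def SU_herm[OF SU_inv_closed[OF g]])
qed

text \<open>Moving \<open>g\<close> to the null vector gives a null vector \<open>N'\<close>. Its
  pairing with the origin has modulus \<open>norm (N' $ None)\<close>, and passing to
  \<open>z\<close> loses at most the fraction \<open>norm z\<close>. This makes estimates at the
  origin locally uniform in \<open>z\<close>.\<close>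

lemma norm_herm_null_ge:
  assumes g: "g \<in> carrier SU" and N: "null_vec N" and z: "norm z \<le> r"
  shows "norm (herm (g *v lift z) N) \<ge> (1 - r) * norm (herm (g *v axis None 1) N)"
proof -
  define N' where "N' = inv\<^bsub>SU\<^esub> g *v N"
  have N': "spatial_norm N' = norm (N' $ None)"
    unfolding N'_def by (rule null_vec_spatial[OF SU_inv_null_vec[OF g N]])
  have "norm (herm (g *v axis None 1) N) = norm (N' $ None)"
    unfolding SU_herm_adjoint[OF g] N'_def[symmetric]
    by (simp add: herm_commute[of "axis None 1"] herm_axis_None)
  then have "(1 - r) * norm (herm (g *v axis None 1) N) \<le> norm (N' $ None) - norm z * norm (N' $ None)"
    using mult_right_mono[OF z norm_ge_zero[of "N' $ None"]] by (simp add: algebra_simps)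
  also have "\<dots> \<le> norm (herm (lift z) N')"
    using norm_herm_ge[of "lift z" N'] by (simp add: N' spatial_norm_lift)
  finally show ?thesis
    by (simp add: SU_herm_adjoint[OF g] N'_def)
qed

lemma herm_column_null_nonzero:
  assumes g: "g \<in> carrier SU" and N: "null_vec N"
  shows "herm (g *v axis None 1) N \<noteq> 0"
  using null_vec_None[OF SU_inv_null_vec[OF g N]]
  by (simp add: SU_herm_adjoint[OF g] herm_commute[of "axis None 1"] herm_axis_None)

text \<open>Take the least \<open>N\<close> for which the first inequality holds. Its failure at
  \<open>N - 1\<close> is the second inequality, and for \<open>N = 0\<close> the second follows
  from \<open>y \<le> x\<close>.\<close>

lemma geometric_balance:
  fixes x y c :: real
  assumes c: "c > 1" and "x > 0" "y > 0" "y \<le> x"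
  obtains N :: nat where "x / c ^ N \<le> c * (y * c ^ N)" "y * c ^ N \<le> c * (x / c ^ N)"
proof -
  define P where "P N \<longleftrightarrow> x / c ^ N \<le> c * (y * c ^ N)" for N
  obtain n where n: "x / y < c ^ n"
    using real_arch_pow[OF c] by blast
  have "P n"
  proof -
    have "x \<le> c ^ n * y"
      using n assms by (simp add: field_simps)
    also have "\<dots> \<le> c ^ n * y * (c * c ^ n)"
      using assms mult_left_mono[of 1 "c * c ^ n" "c ^ n * y"] one_le_power[of c "Suc n"] by simp
    finally show ?thesis
      using c by (simp add: P_def field_simps)
  qed
  define N where "N = (LEAST N. P N)"
  have N: "P N"
    unfolding N_def by (rule LeastI[of P, OF \<open>P n\<close>])
  have "y * c ^ N \<le> c * (x / c ^ N)"
  proof (cases N)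
    case 0
    then show ?thesis
      using assms mult_mono[of 1 c y x] by simp
  next
    case (Suc K)
    then have "\<not> P K"
      using not_less_Least[of K P] by (simp add: N_def)
    then have "c * (y * c ^ K) \<le> x / c ^ K"
      by (simp add: P_def)
    then show ?thesis
      using c by (simp add: Suc field_simps)
  qed
  with N that show ?thesis
    by (simp add: P_def)
qed

section \<open>The data of the series and the action of the cyclic group\<close>

locale poincare_data =
  fixes \<Gamma> :: "(complex ^ 'n::finite option ^ 'n option) set"
    and \<gamma>\<^sub>0 :: "complex ^ 'n option ^ 'n option" and lam :: real
    and v :: "nat \<Rightarrow> complex ^ 'n option" and X Y :: "complex ^ 'n option"
    and m k :: nat and l :: "nat \<Rightarrow> nat"
  assumes \<Gamma>: "subgroup \<Gamma> SU" and discrete: "discrete \<Gamma>" and \<gamma>\<^sub>0: "\<gamma>\<^sub>0 \<in> \<Gamma>"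
    and lam: "\<bar>lam\<bar> > 1"
    and v: "\<And>i. i \<in> {1..m} \<Longrightarrow> \<gamma>\<^sub>0 *v v i = v i"
    and X: "null_vec X" "\<gamma>\<^sub>0 *v X = of_real lam *s X"
    and Y: "null_vec Y" "\<gamma>\<^sub>0 *v Y = of_real (inverse lam) *s Y"
    and even_l: "even (\<Sum>i = 1..m. l i)" and k: "k \<ge> 1"
begin

abbreviation "H \<equiv> generate SU {\<gamma>\<^sub>0}"
abbreviation "cosets \<equiv> cyclic_cosets \<Gamma> \<gamma>\<^sub>0"
abbreviation "q \<equiv> q_fun v X Y m l k"

definition F :: "complex ^ 'n option \<Rightarrow> complex"
  where "F u = (\<Prod>i = 1..m. herm u (v i) ^ l i) /
    (herm u X * herm u Y) ^ ((CARD('n) + 1) * k + (\<Sum>i = 1..m. l i) div 2)"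

lemma q_eq: "q z = F (lift z)"
  by (simp add: q_fun_def F_def)

lemma SU: "g \<in> \<Gamma> \<Longrightarrow> g \<in> carrier SU"
  using subgroup.mem_carrier[OF \<Gamma>] .

lemma lam_nonzero: "lam \<noteq> 0"
  using lam by auto

text \<open>Orthogonal null vectors are proportional, but \<open>X\<close> and \<open>Y\<close>
  belong to the distinct eigenvalues \<open>lam\<close> and \<open>inverse lam\<close>.\<close>

lemma herm_XY: "herm X Y \<noteq> 0"
proof
  assume "herm X Y = 0"
  then have *: "Y $ None *s X = X $ None *s Y"
    by (rule herm_null_eq_0_imp_parallel[OF X(1) Y(1)])
  then have "\<gamma>\<^sub>0 *v (Y $ None *s X) = \<gamma>\<^sub>0 *v (X $ None *s Y)"
    by simp
  then have "Y $ None *s (of_real lam *s X) = X $ None *s (of_real (inverse lam) *s Y)"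
    by (simp add: vector_scalar_commute X Y)
  then have "Y $ None * (of_real lam * X $ None) = X $ None * (of_real (inverse lam) * Y $ None)"
    by (metis vector_smult_component)
  then have "complex_of_real lam = of_real (inverse lam)"
    using null_vec_None[OF X(1)] null_vec_None[OF Y(1)] by simp
  then have "lam = inverse lam"
    using of_real_eq_iff by blast
  then have "\<bar>lam\<bar> * \<bar>lam\<bar> = 1"
    using lam_nonzero by (metis abs_mult abs_one right_inverse)
  then show False
    using less_1_mult[OF lam lam] by linarith
qed

text \<open>Invariance of the form multiplies the pairing of a fixed vector with \<open>X\<close> or
  \<open>Y\<close> by an eigenvalue different from 1.\<close>

lemma herm_v_orth:
  assumes "i \<in> {1..m}"
  shows "herm (v i) X = 0" "herm (v i) Y = 0"
proof -
  have g: "\<gamma>\<^sub>0 \<in> carrier SU"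
    by (rule SU[OF \<gamma>\<^sub>0])
  have "lam \<noteq> 1"
    using lam by auto
  then have l1: "complex_of_real lam \<noteq> 1" "complex_of_real (inverse lam) \<noteq> 1"
    by (metis of_real_eq_1_iff, metis inverse_eq_1_iff of_real_eq_1_iff)
  have "herm (v i) X = of_real lam * herm (v i) X"
    using SU_herm[OF g, of "v i" X] by (simp add: v[OF assms] X herm_scale_right)
  with l1(1) show "herm (v i) X = 0"
    by simp
  have "herm (v i) Y = of_real (inverse lam) * herm (v i) Y"
    using SU_herm[OF g, of "v i" Y] unfolding v[OF assms] Y herm_scale_right by simp
  with l1(2) show "herm (v i) Y = 0"
    by simp
qed

text \<open>The effect of an element of the cyclic group recorded through pairings. In this form it
  passes to products and inverses, and both the invariance of \<open>F\<close> and the balancing of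
  representatives can be read off.\<close>

definition axis_scaling :: "complex ^ 'n option ^ 'n option \<Rightarrow> complex \<Rightarrow> bool"
  where "axis_scaling g c \<longleftrightarrow> c \<noteq> 0 \<and> (\<forall>u. herm (g *v u) X = c * herm u X \<and>
    herm (g *v u) Y = herm u Y / c \<and> (\<forall>i\<in>{1..m}. herm (g *v u) (v i) = herm u (v i)))"

lemma axis_scaling_\<gamma>\<^sub>0: "axis_scaling \<gamma>\<^sub>0 (of_real (inverse lam))"
proof -
  have g: "\<gamma>\<^sub>0 \<in> carrier SU"
    by (rule SU[OF \<gamma>\<^sub>0])
  have "herm (\<gamma>\<^sub>0 *v u) X = of_real (inverse lam) * herm u X" for u
    using SU_herm[OF g, of u X, symmetric] lam_nonzero by (simp add: X herm_scale_right)
  moreover have "herm (\<gamma>\<^sub>0 *v u) Y = herm u Y / of_real (inverse lam)" for u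
    using SU_herm[OF g, of u Y, symmetric] lam_nonzero by (simp add: Y herm_scale_right)
  moreover have "herm (\<gamma>\<^sub>0 *v u) (v i) = herm u (v i)" if "i \<in> {1..m}" for u i
    using SU_herm[OF g, of u "v i"] by (simp add: v[OF that])
  ultimately show ?thesis
    using lam_nonzero by (simp add: axis_scaling_def)
qed

lemma axis_scaling_inv:
  assumes "axis_scaling g c" "g \<in> carrier SU"
  shows "axis_scaling (inv\<^bsub>SU\<^esub> g) (inverse c)"
proof -
  have g: "g *v (inv\<^bsub>SU\<^esub> g *v u) = u" for u
    by (simp add: matrix_vector_mul_assoc SU_mult_inv[OF assms(2)])
  have c: "c \<noteq> 0"
    using assms(1) by (simp add: axis_scaling_def)
  have "herm (inv\<^bsub>SU\<^esub> g *v u) X = inverse c * herm u X \<and>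
      herm (inv\<^bsub>SU\<^esub> g *v u) Y = herm u Y / inverse c \<and>
      (\<forall>i\<in>{1..m}. herm (inv\<^bsub>SU\<^esub> g *v u) (v i) = herm u (v i))" for u
  proof -
    have "herm u X = c * herm (inv\<^bsub>SU\<^esub> g *v u) X" "herm u Y = herm (inv\<^bsub>SU\<^esub> g *v u) Y / c"
      "\<forall>i\<in>{1..m}. herm u (v i) = herm (inv\<^bsub>SU\<^esub> g *v u) (v i)"
      using spec[OF conjunct2[OF assms(1)[unfolded axis_scaling_def]], of "inv\<^bsub>SU\<^esub> g *v u"]
      unfolding g by blast+
    with c show ?thesis
      by simp
  qed
  with c show ?thesis
    by (simp add: axis_scaling_def)
qed

lemma axis_scaling_mult:
  assumes "axis_scaling g c" "axis_scaling h d"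
  shows "axis_scaling (g ** h) (c * d)"
  using assms by (simp add: axis_scaling_def flip: matrix_vector_mul_assoc)

lemma axis_scaling_one: "axis_scaling (mat 1) 1"
  by (simp add: axis_scaling_def)

lemma H_axis_scaling: "g \<in> H \<Longrightarrow> \<exists>c. axis_scaling g c"
proof (induction rule: generate.induct)
  case one
  then show ?case
    using axis_scaling_one by (auto simp: SU_one)
next
  case (incl h)
  then show ?case
    using axis_scaling_\<gamma>\<^sub>0 by auto
next
  case (inv h)
  then show ?case
    using axis_scaling_inv[OF axis_scaling_\<gamma>\<^sub>0 SU[OF \<gamma>\<^sub>0]] by auto
next
  case (eng h1 h2)
  then show ?case
    using axis_scaling_mult by (metis SU_mult)
qed

lemma F_H_invariant: "g \<in> H \<Longrightarrow> F (g *v u) = F u"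
proof -
  assume "g \<in> H"
  then obtain c where c: "axis_scaling g c"
    using H_axis_scaling by blast
  then have "herm (g *v u) X * herm (g *v u) Y = herm u X * herm u Y"
    by (simp add: axis_scaling_def)
  moreover have "(\<Prod>i = 1..m. herm (g *v u) (v i) ^ l i) = (\<Prod>i = 1..m. herm u (v i) ^ l i)"
    by (intro prod.cong) (use c in \<open>auto simp: axis_scaling_def\<close>)
  ultimately show ?thesis
    by (simp add: F_def)
qed

section \<open>Homogeneity and the terms of the series\<close>

text \<open>With \<open>L\<close> the sum of the \<open>l i\<close>, the numerator has degree
  \<open>L\<close> and the denominator \<open>2 * (CARD('n) + 1) * k + L\<close>; evenness of
  \<open>L\<close> makes \<open>2 * (L div 2) = L\<close>.\<close>

lemma F_scale:
  assumes "c \<noteq> 0"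
  shows "F (c *s u) * c ^ (2 * k * (CARD('n) + 1)) = F u"
proof -
  define L where "L = (\<Sum>i = 1..m. l i)"
  define p where "p = (CARD('n) + 1) * k + L div 2"
  have L: "2 * (L div 2) = L"
    using even_l by (simp add: L_def)
  have p: "2 * p = L + 2 * k * (CARD('n) + 1)"
    using L by (simp add: p_def algebra_simps)
  have "(\<Prod>i = 1..m. herm (c *s u) (v i) ^ l i) = c ^ L * (\<Prod>i = 1..m. herm u (v i) ^ l i)"
    by (simp add: herm_scale_left power_mult_distrib prod.distrib L_def power_sum)
  moreover have "(herm (c *s u) X * herm (c *s u) Y) ^ p = c ^ (2 * p) * (herm u X * herm u Y) ^ p"
    by (simp add: herm_scale_left power_mult_distrib power_mult power2_eq_square mult_ac)
  moreover have "(c ^ L * a) / (c ^ (2 * p) * b) * c ^ (2 * k * (CARD('n) + 1)) = a / b" for a b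
    unfolding p power_add using assms by simp
  ultimately show ?thesis
    unfolding F_def L_def[symmetric] p_def[symmetric] by simp
qed

text \<open>The scalar dividing out the last coordinate is absorbed by homogeneity. The extra factor
  \<open>a\<close> lets the lemma serve both for a single term (\<open>a = mat 1\<close>) and for
  translating a term by an element of the group.\<close>

lemma slash_eq:
  fixes z :: "complex ^ 'n"
  assumes g: "g \<in> carrier SU" and z: "z \<in> ball 0 1"
  shows "F (a *v lift (act g z)) * det (jacobi g z) ^ (2 * k) = F ((a ** g) *v lift z)"
proof -
  define d where "d = (g *v lift z) $ None"
  have d: "d \<noteq> 0"
    unfolding d_def by (rule SU_lift_None[OF g z])
  have "a *v lift (act g z) = inverse d *s ((a ** g) *v lift z)"
    by (simp add: lift_act[OF g z] d_def[symmetric] vector_scalar_commute matrix_vector_mul_assoc)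
  moreover have "det (jacobi g z) ^ (2 * k) = inverse d ^ (2 * k * (CARD('n) + 1))"
    unfolding det_jacobi[OF SU_det[OF g] SU_lift_None[OF g z]] d_def[symmetric]
    by (simp only: inverse_eq_divide[symmetric] power_inverse[symmetric] power_mult[symmetric] mult.commute)
  ultimately show ?thesis
    using F_scale[of "inverse d" "(a ** g) *v lift z"] d by simp
qed

lemma H_subgroup: "subgroup H SU"
  by (rule group.generate_is_subgroup[OF group_SU]) (use SU[OF \<gamma>\<^sub>0] in simp)

lemma H_subset: "H \<subseteq> \<Gamma>"
  by (rule group.generate_subgroup_incl[OF group_SU _ \<Gamma>]) (use \<gamma>\<^sub>0 in simp)

lemma cosets_eq: "cosets = (\<lambda>a. (\<lambda>h. h ** a) ` H) ` \<Gamma>"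
  unfolding cyclic_cosets_def RCOSETS_def r_coset_def by (auto simp: SU_def)

lemma coset_eqI:
  assumes "C \<in> cosets" "b \<in> C"
  shows "b \<in> \<Gamma>" "C = (\<lambda>h. h ** b) ` H"
proof -
  obtain a where a: "a \<in> \<Gamma>" "C = (\<lambda>h. h ** a) ` H"
    using assms(1) by (auto simp: cosets_eq)
  obtain h where h: "h \<in> H" "b = h ** a"
    using assms(2) a by auto
  show "b \<in> \<Gamma>"
    using subgroup.m_closed[OF \<Gamma>, of h a] h a H_subset by auto
  have hS: "h \<in> carrier SU"
    using h(1) H_subset SU by blast
  show "C = (\<lambda>h. h ** b) ` H"
  proof
    show "C \<subseteq> (\<lambda>h. h ** b) ` H"
    proof
      fix g assume "g \<in> C"
      then obtain h' where h': "h' \<in> H" "g = h' ** a"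
        using a by auto
      have "h' ** inv\<^bsub>SU\<^esub> h \<in> H"
        using subgroup.m_closed[OF H_subgroup h'(1) subgroup.m_inv_closed[OF H_subgroup h(1)]] by simp
      moreover have "g = (h' ** inv\<^bsub>SU\<^esub> h) ** b"
      proof -
        have "(h' ** inv\<^bsub>SU\<^esub> h) ** b = h' ** (inv\<^bsub>SU\<^esub> h ** h) ** a"
          by (simp add: h matrix_mul_assoc)
        then show ?thesis
          by (simp add: SU_inv_mult[OF hS] h')
      qed
      ultimately show "g \<in> (\<lambda>h. h ** b) ` H"
        by blast
    qed
    show "(\<lambda>h. h ** b) ` H \<subseteq> C"
    proof (rule image_subsetI)
      fix h' assume "h' \<in> H"
      then have "h' ** h \<in> H"
        using subgroup.m_closed[OF H_subgroup _ h(1)] by simp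
      moreover have "h' ** b = (h' ** h) ** a"
        by (simp add: h matrix_mul_assoc)
      ultimately show "h' ** b \<in> C"
        using a by blast
    qed
  qed
qed

text \<open>By invariance of \<open>F\<close> all representatives give one value, so
  \<open>the_elem\<close> is applied to a singleton. Any convenient representative may be used from
  here on.\<close>

lemma poincare_term_eq:
  assumes C: "C \<in> cosets" and a: "a \<in> C" and z: "z \<in> ball 0 1"
  shows "poincare_term q k C z = F (a *v lift z)"
proof -
  have "q (act g z) * det (jacobi g z) ^ (2 * k) = F (a *v lift z)" if "g \<in> C" for g
  proof -
    have "g \<in> (\<lambda>h. h ** a) ` H"
      using coset_eqI(2)[OF C a] that by blast
    then obtain h where h: "h \<in> H" "g = h ** a"
      by blast
    have "q (act g z) * det (jacobi g z) ^ (2 * k) = F (g *v lift z)"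
      using slash_eq[OF SU[OF coset_eqI(1)[OF C that]] z, of "mat 1"] by (simp add: q_eq)
    also have "\<dots> = F (a *v lift z)"
      by (simp add: h F_H_invariant flip: matrix_vector_mul_assoc)
    finally show ?thesis .
  qed
  then have "(\<lambda>g. q (act g z) * det (jacobi g z) ^ (2 * k)) ` C = {F (a *v lift z)}"
    using a by auto
  then show ?thesis
    by (simp add: poincare_term_def)
qed

section \<open>The majorant\<close>

text \<open>Each pairing with \<open>v i\<close> is at most a constant times \<open>sqrt Q\<close>,
  where \<open>Q\<close> is the product of the moduli of the pairings with \<open>X\<close> and
  \<open>Y\<close>. Together they give \<open>Q ^ (L div 2)\<close>, which cancels the surplus
  exponent in the denominator.\<close>

lemma F_bound:
  obtains K where "K \<ge> 0" "\<And>u. Re (herm u u) \<le> 0 \<Longrightarrow> herm u X \<noteq> 0 \<Longrightarrow> herm u Y \<noteq> 0 \<Longrightarrow>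
    norm (F u) \<le> K / (norm (herm u X) * norm (herm u Y)) ^ ((CARD('n) + 1) * k)"
proof -
  define A where "A i = sqrt (2 * Re (herm (v i) (v i)) / norm (herm X Y))" for i
  define K where "K = (\<Prod>i = 1..m. A i ^ l i)"
  define L where "L = (\<Sum>i = 1..m. l i)"
  have A: "A i \<ge> 0" if "i \<in> {1..m}" for i
    unfolding A_def using orth_null_nonneg[OF X(1) herm_v_orth(1)[OF that]] by simp
  have "norm (F u) \<le> K / (norm (herm u X) * norm (herm u Y)) ^ ((CARD('n) + 1) * k)"
    if u: "Re (herm u u) \<le> 0" "herm u X \<noteq> 0" "herm u Y \<noteq> 0" for u
  proof -
    define Q where "Q = norm (herm u X) * norm (herm u Y)"
    have Q: "Q > 0"
      using u by (simp add: Q_def)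
    have "norm (herm u (v i)) \<le> A i * sqrt Q" if i: "i \<in> {1..m}" for i
      unfolding A_def real_sqrt_mult[symmetric] Q_def
      by (rule real_le_rsqrt, rule herm_axis_bound[OF X(1) Y(1) herm_XY herm_v_orth[OF i] u(1)])
    then have "(\<Prod>i = 1..m. norm (herm u (v i)) ^ l i) \<le> (\<Prod>i = 1..m. (A i * sqrt Q) ^ l i)"
      by (intro prod_mono conjI power_mono) auto
    also have "\<dots> = K * sqrt Q ^ L"
      by (simp add: K_def L_def power_mult_distrib prod.distrib power_sum)
    also have "sqrt Q ^ L = (sqrt Q ^ 2) ^ (L div 2)"
      using even_l by (simp add: L_def flip: power_mult)
    also have "\<dots> = Q ^ (L div 2)"
      using Q by simp
    finally have num: "(\<Prod>i = 1..m. norm (herm u (v i)) ^ l i) \<le> K * Q ^ (L div 2)" .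
    have "norm (F u) = (\<Prod>i = 1..m. norm (herm u (v i)) ^ l i) / Q ^ ((CARD('n) + 1) * k + L div 2)"
      unfolding F_def L_def[symmetric] Q_def
      by (simp only: norm_divide norm_mult norm_power prod_norm[symmetric])
    also have "\<dots> \<le> K * Q ^ (L div 2) / Q ^ ((CARD('n) + 1) * k + L div 2)"
      using Q num by (intro divide_right_mono) auto
    also have "\<dots> = K / Q ^ ((CARD('n) + 1) * k)"
      using Q by (simp add: power_add)
    finally show ?thesis
      by (simp add: Q_def)
  qed
  moreover have "K \<ge> 0"
    unfolding K_def using A by (intro prod_nonneg) auto
  ultimately show ?thesis
    using that by blast
qed

text \<open>The element is the \<open>N\<close>-th power of the inverse of
  \<open>\<gamma>\<^sub>0\<close>, since \<open>\<gamma>\<^sub>0\<close> itself scales the pairing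
  with \<open>X\<close> by \<open>inverse lam\<close>.\<close>

lemma H_power:
  obtains g where "g \<in> H" "axis_scaling g (of_real lam ^ N)"
proof -
  have "\<exists>g\<in>H. axis_scaling g (of_real lam ^ N)"
  proof (induction N)
    case 0
    show ?case
      using axis_scaling_one subgroup.one_closed[OF H_subgroup] by (auto simp: SU_one)
  next
    case (Suc N)
    then obtain g where g: "g \<in> H" "axis_scaling g (of_real lam ^ N)"
      by blast
    have "inv\<^bsub>SU\<^esub> \<gamma>\<^sub>0 \<in> H"
      by (rule generate.inv) simp
    then have "inv\<^bsub>SU\<^esub> \<gamma>\<^sub>0 ** g \<in> H"
      using subgroup.m_closed[OF H_subgroup _ g(1)] by simp
    moreover have "axis_scaling (inv\<^bsub>SU\<^esub> \<gamma>\<^sub>0) (of_real lam)"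
      using axis_scaling_inv[OF axis_scaling_\<gamma>\<^sub>0 SU[OF \<gamma>\<^sub>0]] by simp
    then have "axis_scaling (inv\<^bsub>SU\<^esub> \<gamma>\<^sub>0 ** g) (of_real lam * of_real lam ^ N)"
      by (rule axis_scaling_mult[OF _ g(2)])
    ultimately show ?case
      by auto
  qed
  with that show ?thesis
    by blast
qed

lemma H_power_inverse:
  obtains g where "g \<in> H" "axis_scaling g (inverse (of_real lam ^ N))"
proof -
  obtain g where g: "g \<in> H" "axis_scaling g (of_real lam ^ N)"
    by (rule H_power)
  have "inv\<^bsub>SU\<^esub> g \<in> H"
    by (rule subgroup.m_inv_closed[OF H_subgroup g(1)])
  moreover have "axis_scaling (inv\<^bsub>SU\<^esub> g) (inverse (of_real lam ^ N))"
    using axis_scaling_inv[OF g(2)] g(1) H_subset SU by blast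
  ultimately show ?thesis
    using that by blast
qed

text \<open>Elements of the cyclic group scale the two pairings by reciprocal factors, so a suitable
  power shrinks the larger one and enlarges the smaller until they agree up to
  \<open>\<bar>lam\<bar>\<close>.\<close>

lemma H_balance:
  assumes "herm u X \<noteq> 0" "herm u Y \<noteq> 0"
  obtains g where "g \<in> H"
    "norm (herm (g *v u) X) \<le> \<bar>lam\<bar> * norm (herm (g *v u) Y)"
    "norm (herm (g *v u) Y) \<le> \<bar>lam\<bar> * norm (herm (g *v u) X)"
proof (cases "norm (herm u Y) \<le> norm (herm u X)")
  case True
  obtain N where N: "norm (herm u X) / \<bar>lam\<bar> ^ N \<le> \<bar>lam\<bar> * (norm (herm u Y) * \<bar>lam\<bar> ^ N)"
    "norm (herm u Y) * \<bar>lam\<bar> ^ N \<le> \<bar>lam\<bar> * (norm (herm u X) / \<bar>lam\<bar> ^ N)"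
    by (rule geometric_balance[OF lam _ _ True]) (use assms in auto)
  obtain g where g: "g \<in> H" "axis_scaling g (inverse (of_real lam ^ N))"
    by (rule H_power_inverse)
  then have "norm (herm (g *v u) X) = norm (herm u X) / \<bar>lam\<bar> ^ N"
    "norm (herm (g *v u) Y) = norm (herm u Y) * \<bar>lam\<bar> ^ N"
    by (simp_all add: axis_scaling_def norm_mult norm_inverse norm_power norm_divide field_simps)
  with N g(1) that show ?thesis
    by simp
next
  case False
  then have "norm (herm u X) \<le> norm (herm u Y)"
    by simp
  then obtain N where N: "norm (herm u Y) / \<bar>lam\<bar> ^ N \<le> \<bar>lam\<bar> * (norm (herm u X) * \<bar>lam\<bar> ^ N)"
    "norm (herm u X) * \<bar>lam\<bar> ^ N \<le> \<bar>lam\<bar> * (norm (herm u Y) / \<bar>lam\<bar> ^ N)"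
    by (rule geometric_balance[OF lam, rotated 2]) (use assms in auto)
  obtain g where g: "g \<in> H" "axis_scaling g (of_real lam ^ N)"
    by (rule H_power)
  then have "norm (herm (g *v u) X) = norm (herm u X) * \<bar>lam\<bar> ^ N"
    "norm (herm (g *v u) Y) = norm (herm u Y) / \<bar>lam\<bar> ^ N"
    by (simp_all add: axis_scaling_def norm_mult norm_inverse norm_power norm_divide mult.commute)
  with N g(1) that show ?thesis
    by simp
qed

text \<open>Balanced representatives, for which \<open>last_coordinate_bound\<close> turns a sum of
  pairings into their product. Injectivity, from disjointness of cosets, lets summability over the
  group pass to the cosets.\<close>

lemma coset_representatives:
  obtains s c where "c > 0" "inj_on s cosets" "\<And>C. C \<in> cosets \<Longrightarrow> s C \<in> C"
    "\<And>C. C \<in> cosets \<Longrightarrow> (norm (s C $ None $ None))\<^sup>2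
      \<le> c * (norm (herm (s C *v axis None 1) X) * norm (herm (s C *v axis None 1) Y))"
proof -
  obtain B where B: "B > 0"
    "\<And>u. Re (herm u u) \<le> 0 \<Longrightarrow> norm (u $ None) \<le> B * (norm (herm u X) + norm (herm u Y))"
    using last_coordinate_bound[OF X(1) Y(1) herm_XY] by blast
  \<comment> \<open>The factor \<open>4 * \<bar>lam\<bar>\<close> bounds
    \<open>(x + y)\<^sup>2\<close> by \<open>x * y\<close> for balanced \<open>x\<close> and
    \<open>y\<close>.\<close>
  define c where "c = B\<^sup>2 * (4 * \<bar>lam\<bar>)"
  define good where "good b \<longleftrightarrow> (norm (b $ None $ None))\<^sup>2
      \<le> c * (norm (herm (b *v axis None 1) X) * norm (herm (b *v axis None 1) Y))"
    for b :: "complex ^ 'n option ^ 'n option"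
  have ex: "\<exists>b. b \<in> C \<and> good b" if C: "C \<in> cosets" for C
  proof -
    obtain a where a: "a \<in> \<Gamma>" "C = (\<lambda>h. h ** a) ` H"
      using C by (auto simp: cosets_eq)
    obtain g where g: "g \<in> H"
      "norm (herm (g *v (a *v axis None 1)) X) \<le> \<bar>lam\<bar> * norm (herm (g *v (a *v axis None 1)) Y)"
      "norm (herm (g *v (a *v axis None 1)) Y) \<le> \<bar>lam\<bar> * norm (herm (g *v (a *v axis None 1)) X)"
      by (rule H_balance[OF herm_column_null_nonzero[OF SU[OF a(1)] X(1)]
            herm_column_null_nonzero[OF SU[OF a(1)] Y(1)]])
    define b where "b = g ** a"
    define u where "u = b *v axis None 1"
    define x y where "x = norm (herm u X)" and "y = norm (herm u Y)"
    have u: "u = g *v (a *v axis None 1)"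
      by (simp add: u_def b_def matrix_vector_mul_assoc)
    have xy: "x \<ge> 0" "y \<ge> 0" "x \<le> \<bar>lam\<bar> * y" "y \<le> \<bar>lam\<bar> * x"
      using g by (simp_all add: x_def y_def u)
    have b: "b \<in> C"
      using g a by (auto simp: b_def)
    have "herm u u = -1"
      unfolding u_def by (rule SU_last_column[OF SU[OF coset_eqI(1)[OF C b]]])
    then have "norm (u $ None) \<le> B * (x + y)"
      unfolding x_def y_def by (intro B) simp
    then have "(norm (u $ None))\<^sup>2 \<le> (B * (x + y))\<^sup>2"
      by (intro power_mono) auto
    also have "\<dots> \<le> B\<^sup>2 * (4 * \<bar>lam\<bar> * (x * y))"
    proof -
      have "x * x \<le> \<bar>lam\<bar> * (x * y)" "y * y \<le> \<bar>lam\<bar> * (x * y)"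
        using mult_left_mono[OF xy(3,1)] mult_left_mono[OF xy(4,2)] by (simp_all add: mult_ac)
      moreover have "x * y \<le> \<bar>lam\<bar> * (x * y)"
        using lam xy mult_right_mono[of 1 "\<bar>lam\<bar>" "x * y"] by simp
      ultimately have "(x + y)\<^sup>2 \<le> 4 * \<bar>lam\<bar> * (x * y)"
        by (simp add: power2_eq_square algebra_simps)
      then show ?thesis
        by (simp add: power_mult_distrib mult_left_mono)
    qed
    also have "\<dots> = c * (x * y)"
      by (simp add: c_def)
    finally have "good b"
      by (simp add: good_def x_def y_def u_def matrix_vector_mult_axis)
    with b show ?thesis
      by blast
  qed
  define s where "s C = (SOME b. b \<in> C \<and> good b)" for C
  have s: "s C \<in> C" "good (s C)" if "C \<in> cosets" for C
    using someI_ex[OF ex[OF that]] by (simp_all add: s_def)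
  have "inj_on s cosets"
  proof (rule inj_onI)
    fix C D assume CD: "C \<in> cosets" "D \<in> cosets" "s C = s D"
    show "C = D"
      using coset_eqI(2)[OF CD(1) s(1)] coset_eqI(2)[OF CD(2) s(1)] CD by simp
  qed
  moreover have "c > 0"
    using B lam by (simp add: c_def)
  ultimately show ?thesis
    using that[of c s] s by (simp add: good_def)
qed

lemma majorant:
  assumes r: "r < 1"
  obtains M where "M summable_on cosets"
    "\<And>C z. C \<in> cosets \<Longrightarrow> z \<in> cball 0 r \<Longrightarrow> norm (poincare_term q k C z) \<le> M C"
proof -
  obtain s c where c: "c > 0" and inj: "inj_on s cosets" and s: "\<And>C. C \<in> cosets \<Longrightarrow> s C \<in> C"
    and sc: "\<And>C. C \<in> cosets \<Longrightarrow> (norm (s C $ None $ None))\<^sup>2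
      \<le> c * (norm (herm (s C *v axis None 1) X) * norm (herm (s C *v axis None 1) Y))"
    by (rule coset_representatives) (rule that)
  obtain K where K: "K \<ge> 0" "\<And>u. Re (herm u u) \<le> 0 \<Longrightarrow> herm u X \<noteq> 0 \<Longrightarrow> herm u Y \<noteq> 0 \<Longrightarrow>
    norm (F u) \<le> K / (norm (herm u X) * norm (herm u Y)) ^ ((CARD('n) + 1) * k)"
    using F_bound by blast
  define N where "N = (CARD('n) + 1) * k"
  \<comment> \<open>Two factors \<open>1 - r\<close> come from moving the origin to \<open>z\<close>
    in both pairings, and \<open>1 / c\<close> from the choice of representative.\<close>
  define d where "d = (1 - r)\<^sup>2 / c"
  have d: "d > 0"
    using r c by (simp add: d_def)
  define M where "M C = K / d ^ N * (1 / norm (s C $ None $ None) ^ (2 * CARD('n) + 2))" for C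
  have s\<Gamma>: "s C \<in> \<Gamma>" if "C \<in> cosets" for C
    by (rule coset_eqI(1)[OF that s[OF that]])
  have "(\<lambda>g. 1 / norm (g $ None $ None) ^ (2 * CARD('n) + 2)) summable_on s ` cosets"
    by (rule summable_on_subset_banach[OF corner_summable[OF \<Gamma> discrete]]) (use s\<Gamma> in auto)
  then have "(\<lambda>C. 1 / norm (s C $ None $ None) ^ (2 * CARD('n) + 2)) summable_on cosets"
    unfolding summable_on_reindex[OF inj] by (simp add: o_def)
  then have "M summable_on cosets"
    unfolding M_def by (rule summable_on_cmult_right)
  moreover have "norm (poincare_term q k C z) \<le> M C" if C: "C \<in> cosets" and z: "z \<in> cball 0 r" for C z
  proof -
    define g where "g = s C"
    define x y t where "x = norm (herm (g *v axis None 1) X)" and "y = norm (herm (g *v axis None 1) Y)"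
      and "t = norm (g $ None $ None)"
    have g: "g \<in> carrier SU"
      unfolding g_def by (rule SU[OF s\<Gamma>[OF C]])
    have zb: "z \<in> ball 0 1" and zr: "norm z \<le> r"
      using z r by auto
    define u where "u = g *v lift z"
    have t1: "1 \<le> t"
      unfolding t_def by (rule SU_corner_ge_1[OF g])
    have xy: "x > 0" "y > 0"
      using herm_column_null_nonzero[OF g X(1)] herm_column_null_nonzero[OF g Y(1)] by (simp_all add: x_def y_def)
    have ux: "(1 - r) * x \<le> norm (herm u X)" and uy: "(1 - r) * y \<le> norm (herm u Y)"
      unfolding u_def x_def y_def by (rule norm_herm_null_ge[OF g _ zr] X Y)+
    have pos: "0 < (1 - r) * x" "0 < (1 - r) * y"
      using r xy by simp_all
    have "d * t\<^sup>2 \<le> d * (c * (x * y))"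
      using sc[OF C] d by (intro mult_left_mono) (simp_all add: t_def x_def y_def g_def)
    also have "\<dots> = ((1 - r) * x) * ((1 - r) * y)"
      using c by (simp add: d_def power2_eq_square)
    also have "\<dots> \<le> norm (herm u X) * norm (herm u Y)"
      using ux uy pos by (intro mult_mono) auto
    finally have Q: "d * t\<^sup>2 \<le> norm (herm u X) * norm (herm u Y)" .
    have "herm u X \<noteq> 0" "herm u Y \<noteq> 0"
      using ux uy pos by auto
    moreover have "Re (herm u u) \<le> 0"
      using herm_lift_negative[OF zb] by (simp add: u_def SU_herm[OF g])
    ultimately have "norm (F u) \<le> K / (norm (herm u X) * norm (herm u Y)) ^ N"
      unfolding N_def by (intro K)
    also have "\<dots> \<le> K / (d * t\<^sup>2) ^ N"
    proof (intro frac_le power_mono zero_less_power)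
      show "0 < d * t\<^sup>2"
        using d t1 by simp
    qed (use K Q d in auto)
    also have "\<dots> = K / d ^ N * (1 / t ^ (2 * N))"
      by (simp add: power_mult_distrib power_mult)
    also have "\<dots> \<le> K / d ^ N * (1 / t ^ (2 * CARD('n) + 2))"
    proof (rule mult_left_mono)
      \<comment> \<open>Here \<open>k \<ge> 1\<close> enters: the decay is at least the one summed
        in \<open>corner_summable\<close>.\<close>
      have "2 * CARD('n) + 2 \<le> 2 * N"
        using mult_le_mono2[OF k, of "CARD('n) + 1"] by (simp add: N_def)
      then show "1 / t ^ (2 * N) \<le> 1 / t ^ (2 * CARD('n) + 2)"
        using t1 by (intro frac_le power_increasing) auto
    qed (use K d in simp)
    finally have "norm (F u) \<le> M C"
      by (simp add: M_def t_def g_def)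
    then show ?thesis
      using poincare_term_eq[OF C s[OF C] zb] by (simp add: u_def g_def)
  qed
  ultimately show ?thesis
    using that by blast
qed

section \<open>Holomorphy, automorphy and convergence of the series\<close>

text \<open>For a fixed representative the term is a rational expression in pairings of
  \<open>lift z\<close> with constant vectors. The denominator does not vanish on the ball by
  \<open>norm_herm_null_ge\<close>.\<close>

lemma term_holo:
  assumes C: "C \<in> cosets"
  shows "poincare_term q k C holo_on ball 0 1"
proof -
  obtain a where a: "a \<in> C"
    using C subgroup.one_closed[OF H_subgroup] by (auto simp: cosets_eq)
  have aS: "a \<in> carrier SU"
    by (rule SU[OF coset_eqI(1)[OF C a]])
  define b where "b = inv\<^bsub>SU\<^esub> a"
  define p where "p = (CARD('n) + 1) * k + (\<Sum>i = 1..m. l i) div 2"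
  have ab: "herm (a *v u) w = herm u (b *v w)" for u w
    unfolding b_def by (rule SU_herm_adjoint[OF aS])
  have nz: "herm (lift z) (b *v N) \<noteq> 0" if "z \<in> ball 0 1" "null_vec N" for z N
  proof -
    have "0 < (1 - norm z) * norm (herm (a *v axis None 1) N)"
      using herm_column_null_nonzero[OF aS that(2)] that(1) by simp
    also have "\<dots> \<le> norm (herm (a *v lift z) N)"
      by (rule norm_herm_null_ge[OF aS that(2) order_refl])
    finally show ?thesis
      by (simp add: ab)
  qed
  show ?thesis
  proof (rule holo_on_cong[OF open_ball])
    show "poincare_term q k C z = (\<Prod>i = 1..m. herm (lift z) (b *v v i) ^ l i) *
        inverse ((herm (lift z) (b *v X) * herm (lift z) (b *v Y)) ^ p)" if "z \<in> ball 0 1" for z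
      unfolding poincare_term_eq[OF C a that] F_def ab p_def by (simp add: divide_inverse)
    show "(\<lambda>z. (\<Prod>i = 1..m. herm (lift z) (b *v v i) ^ l i) *
        inverse ((herm (lift z) (b *v X) * herm (lift z) (b *v Y)) ^ p)) holo_on ball 0 1"
      by (intro holo_on_mult holo_on_prod holo_on_power holo_on_inverse holo_on_herm_lift)
        (use nz X Y in auto)
  qed
qed

lemma Theta_holo: "Theta \<Gamma> \<gamma>\<^sub>0 q k holo_on ball 0 1"
  unfolding holo_on_def
proof
  fix z :: "complex ^ 'n" assume z: "z \<in> ball 0 1"
  \<comment> \<open>Half the distance to the sphere, so that \<open>ball z r\<close> lies in a
    closed ball of radius below 1, where a majorant exists.\<close>
  define r where "r = (1 - norm z) / 2"
  have r: "r > 0" "norm z + r < 1"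
    using z by (auto simp: r_def field_simps)
  obtain M where M: "M summable_on cosets"
    "\<And>C w. C \<in> cosets \<Longrightarrow> w \<in> cball 0 (norm z + r) \<Longrightarrow> norm (poincare_term q k C w) \<le> M C"
    using majorant[OF r(2)] by blast
  have sub: "w \<in> cball 0 (norm z + r)" if "w \<in> ball z r" for w
    using that norm_triangle_sub[of w z] by (simp add: dist_norm norm_minus_commute)
  have "ball z r \<subseteq> ball 0 1"
    using sub r by fastforce
  then have "poincare_term q k C holo_on ball z r" if "C \<in> cosets" for C
    using term_holo[OF that] unfolding holo_on_def by blast
  then obtain D where "((\<lambda>w. \<Sum>\<^sub>\<infinity>C\<in>cosets. poincare_term q k C w) has_derivative D) (at z)"
      "\<And>c v. D (c *s v) = c * D v"
    using holo_on_infsum_at[of cosets "poincare_term q k" z r M] r(1) M sub by blast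
  moreover have "(\<lambda>w. \<Sum>\<^sub>\<infinity>C\<in>cosets. poincare_term q k C w) = Theta \<Gamma> \<gamma>\<^sub>0 q k"
    by (simp add: fun_eq_iff Theta_def)
  ultimately show "\<exists>D. (Theta \<Gamma> \<gamma>\<^sub>0 q k has_derivative D) (at z) \<and> (\<forall>c v. D (c *s v) = c * D v)"
    by auto
qed

lemma translate_coset:
  assumes "C \<in> cosets" "g \<in> \<Gamma>"
  shows "(\<lambda>h. h ** g) ` C \<in> cosets"
proof -
  obtain a where a: "a \<in> \<Gamma>" "C = (\<lambda>h. h ** a) ` H"
    using assms(1) by (auto simp: cosets_eq)
  have "(\<lambda>h. h ** g) ` C = (\<lambda>h. h ** (a ** g)) ` H"
    unfolding a image_image by (simp add: matrix_mul_assoc)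
  moreover have "a ** g \<in> \<Gamma>"
    using subgroup.m_closed[OF \<Gamma> a(1) assms(2)] by simp
  ultimately show ?thesis
    by (auto simp: cosets_eq)
qed

lemma translate_bij:
  assumes "g \<in> \<Gamma>"
  shows "bij_betw (\<lambda>C. (\<lambda>h. h ** g) ` C) cosets cosets"
proof (rule bij_betw_byWitness[where f' = "\<lambda>C. (\<lambda>h. h ** inv\<^bsub>SU\<^esub> g) ` C"])
  have gS: "g \<in> carrier SU"
    by (rule SU[OF assms])
  have ig: "inv\<^bsub>SU\<^esub> g \<in> \<Gamma>"
    by (rule subgroup.m_inv_closed[OF \<Gamma> assms])
  show "\<forall>C\<in>cosets. (\<lambda>h. h ** inv\<^bsub>SU\<^esub> g) ` (\<lambda>h. h ** g) ` C = C"
    by (simp add: image_image SU_mult_inv[OF gS] flip: matrix_mul_assoc)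
  show "\<forall>C\<in>cosets. (\<lambda>h. h ** g) ` (\<lambda>h. h ** inv\<^bsub>SU\<^esub> g) ` C = C"
    by (simp add: image_image SU_inv_mult[OF gS] flip: matrix_mul_assoc)
  show "(\<lambda>C. (\<lambda>h. h ** g) ` C) ` cosets \<subseteq> cosets" "(\<lambda>C. (\<lambda>h. h ** inv\<^bsub>SU\<^esub> g) ` C) ` cosets \<subseteq> cosets"
    using translate_coset assms ig by blast+
qed

text \<open>By \<open>slash_eq\<close> the automorphy factor turns the term at a coset into the term
  at its right translate by \<open>g\<close>, and right translation permutes the cosets.\<close>

lemma Theta_transform:
  assumes g: "g \<in> \<Gamma>" and z: "z \<in> ball 0 1"
  shows "Theta \<Gamma> \<gamma>\<^sub>0 q k (act g z) * det (jacobi g z) ^ (2 * k) = Theta \<Gamma> \<gamma>\<^sub>0 q k z"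
proof -
  have gS: "g \<in> carrier SU"
    by (rule SU[OF g])
  have "poincare_term q k C (act g z) * det (jacobi g z) ^ (2 * k)
      = poincare_term q k ((\<lambda>h. h ** g) ` C) z" if C: "C \<in> cosets" for C
  proof -
    obtain a where a: "a \<in> C"
      using C subgroup.one_closed[OF H_subgroup] by (auto simp: cosets_eq)
    then have "a ** g \<in> (\<lambda>h. h ** g) ` C"
      by blast
    then have "poincare_term q k ((\<lambda>h. h ** g) ` C) z = F ((a ** g) *v lift z)"
      by (rule poincare_term_eq[OF translate_coset[OF C g] _ z])
    then show ?thesis
      by (simp add: poincare_term_eq[OF C a act_in_ball[OF gS z]] slash_eq[OF gS z])
  qed
  then have "Theta \<Gamma> \<gamma>\<^sub>0 q k (act g z) * det (jacobi g z) ^ (2 * k)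
      = (\<Sum>\<^sub>\<infinity>C\<in>cosets. poincare_term q k ((\<lambda>h. h ** g) ` C) z)"
    unfolding Theta_def infsum_cmult_left'[symmetric] by (rule infsum_cong)
  also have "\<dots> = Theta \<Gamma> \<gamma>\<^sub>0 q k z"
    unfolding Theta_def by (rule infsum_reindex_bij_betw[OF translate_bij[OF g]])
  finally show ?thesis .
qed

lemma Theta_cusp_form: "Theta \<Gamma> \<gamma>\<^sub>0 q k \<in> cusp_forms \<Gamma> (2 * k)"
  using Theta_holo Theta_transform by (simp add: cusp_forms_def)

lemma terms_abs_summable:
  assumes "z \<in> ball 0 1"
  shows "(\<lambda>C. norm (poincare_term q k C z)) summable_on cosets"
proof -
  have "norm z < 1"
    using assms by simp
  then obtain M where M: "M summable_on cosets"
    "\<And>C w. C \<in> cosets \<Longrightarrow> w \<in> cball 0 (norm z) \<Longrightarrow> norm (poincare_term q k C w) \<le> M C"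
    using majorant by blast
  show ?thesis
    by (rule summable_on_comparison_test[OF M(1)]) (use M(2)[of _ z] in auto)
qed

lemma terms_uniform_limit:
  assumes K: "compact K" "K \<subseteq> ball 0 1"
  shows "uniform_limit K (\<lambda>A z. \<Sum>C\<in>A. poincare_term q k C z) (Theta \<Gamma> \<gamma>\<^sub>0 q k)
    (finite_subsets_at_top cosets)"
proof -
  \<comment> \<open>The norm attains its maximum on a nonempty compact set, so \<open>K\<close> lies
    in a closed ball of radius below 1 and the majorant feeds the Weierstrass test.\<close>
  obtain r where r: "r < 1" "K \<subseteq> cball 0 r"
  proof (cases "K = {}")
    case True
    then show ?thesis
      using that[of 0] by simp
  next
    case False
    then obtain w where "w \<in> K" "\<forall>z\<in>K. norm z \<le> norm w"
      using continuous_attains_sup[OF K(1) False continuous_on_norm_id] by auto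
    then show ?thesis
      using that[of "norm w"] K(2) by (auto simp: subset_iff)
  qed
  obtain M where M: "M summable_on cosets"
    "\<And>C w. C \<in> cosets \<Longrightarrow> w \<in> cball 0 r \<Longrightarrow> norm (poincare_term q k C w) \<le> M C"
    using majorant[OF r(1)] by blast
  have "uniform_limit K (\<lambda>A z. \<Sum>C\<in>A. poincare_term q k C z)
      (\<lambda>z. \<Sum>\<^sub>\<infinity>C\<in>cosets. poincare_term q k C z) (finite_subsets_at_top cosets)"
    by (rule Weierstrass_m_test_general[OF _ M(1)]) (use M(2) r(2) in auto)
  then show ?thesis
    by (simp add: Theta_def[abs_def])
qed

end

theorem mainTheorem2:
  fixes \<Gamma> :: "(complex ^ 'n::finite option ^ 'n option) set"
    and \<gamma>\<^sub>0 :: "complex ^ 'n option ^ 'n option"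
    and \<tau> :: "nat \<Rightarrow> complex" and lam :: real
    and v :: "nat \<Rightarrow> complex ^ 'n option" and X Y :: "complex ^ 'n option"
    and m k :: nat and l :: "nat \<Rightarrow> nat"
  assumes "CARD('n) \<ge> 2"
    and "subgroup \<Gamma> SU" and "discrete \<Gamma>" and "cocompact \<Gamma>" and "smooth_quotient \<Gamma>"
    and "\<gamma>\<^sub>0 \<in> \<Gamma>" and "loxodromic \<gamma>\<^sub>0"
    and "\<And>x. det (mat x - \<gamma>\<^sub>0) =
      (\<Prod>i = 1..CARD('n) - 1. x - \<tau> i) * (x - of_real lam) * (x - of_real (inverse lam))"
    and "\<And>i. i \<in> {1..CARD('n) - 1} \<Longrightarrow> norm (\<tau> i) = 1"
    and "\<bar>lam\<bar> > 1"
    and "\<And>i. i \<in> {1..CARD('n) - 1} \<Longrightarrow> positive_vec (v i) \<and> \<gamma>\<^sub>0 *v v i = \<tau> i *s v i"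
    and "null_vec X" and "\<gamma>\<^sub>0 *v X = of_real lam *s X"
    and "null_vec Y" and "\<gamma>\<^sub>0 *v Y = of_real (inverse lam) *s Y"
    and "1 \<le> m" and "m \<le> CARD('n) - 1"
    and "\<And>i. i \<in> {1..m} \<Longrightarrow> \<tau> i = 1"
    and "\<And>i. i \<in> {1..m} \<Longrightarrow> l i > 0" and "even (\<Sum>i = 1..m. l i)"
    and "k \<ge> 1"
  shows "(\<forall>z\<in>ball 0 1.
            (\<lambda>C. norm (poincare_term (q_fun v X Y m l k) k C z)) summable_on cyclic_cosets \<Gamma> \<gamma>\<^sub>0) \<and>
         (\<forall>K. compact K \<and> K \<subseteq> ball 0 1 \<longrightarrow>
            uniform_limit K (\<lambda>F z. \<Sum>C\<in>F. poincare_term (q_fun v X Y m l k) k C z) (Theta \<Gamma> \<gamma>\<^sub>0 (q_fun v X Y m l k) k)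
              (finite_subsets_at_top (cyclic_cosets \<Gamma> \<gamma>\<^sub>0))) \<and>
         Theta \<Gamma> \<gamma>\<^sub>0 (q_fun v X Y m l k) k \<in> cusp_forms \<Gamma> (2 * k)"
proof -
  \<comment> \<open>As \<open>m \<le> CARD('n) - 1\<close>, the first \<open>m\<close> vectors are
    among the listed eigenvectors, and their eigenvalue is 1.\<close>
  have "\<gamma>\<^sub>0 *v v i = v i" if "i \<in> {1..m}" for i
    using assms(11)[of i] assms(17) assms(18)[OF that] that by simp
  then interpret poincare_data \<Gamma> \<gamma>\<^sub>0 lam v X Y m k l
    by (intro poincare_data.intro) (use assms in auto)
  show ?thesis
    using terms_abs_summable terms_uniform_limit Theta_cusp_form by blast
qed

end
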